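(* Let $i\in\{1,2,3,4\}$ and consider the map $F_i$, with $a>1$ if $i\in\{1,2,3\}$ and $a<-1$ if $i=4$. Assume that $0<b<b^*(a)$ or $b>b^*(a)$. Then the curve $\varphi_\infty$ is piecewise $C^{1+\tau}$, where $\tau>0$ is such that $g\in C^{1+\tau}(\mathbb T)$.
   Context: Maps. $\mathbb T=\mathbb R/2\pi\mathbb Z$, $\omega\notin 2\pi\mathbb Q$, and $g:\mathbb T\to\mathbb R$ is of class $C^{1+\tau}$ for some $\tau>0$. For $i=1,2,3,4$, $F_i:\mathbb R\times\mathbb T\to\mathbb R\times\mathbb T$ is $F_i(x,\theta)=(h_i(x)+\sigma_i b\,g(\theta),\ \theta+\omega)$ with $\sigma_1=\sigma_4=-1$, $\sigma_2=\sigma_3=1$, and - $h_1(x)=-\frac{\pi}{2}$ if $x<-\frac{\pi}{2a}$, $h_1(x)=ax$ if $|x|\le\frac{\pi}{2a}$, $h_1(x)=\frac{\pi}{2}$ if $x>\frac{\pi}{2a}$; - $h_2(x)=a(x+\delta)$ if $x<-\delta$, $h_2(x)=0$ if $|x|\le\delta$, $h_2(x)=a(x-\delta)$ if $x>\delta$ (here $\delta>0$ is fixed); - $h_3(x)=ax$ if $x>-\frac1a$, $h_3(x)=-1$ if $x\le-\frac1a$; - $h_4(x)=ax$ if $x>\frac1a$, $h_4(x)=1$ if $x\le\frac1a$. Put $\mathcal F_i(\varphi)(\theta)=h_i(\varphi(\theta-\omega))+\sigma_i b\,g(\theta-\omega)$ for $\varphi:\mathbb T\to\mathbb R$. Curves.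 $\mu_i$ is the continuous solution of: $\mu_1(\theta+\omega)=a\mu_1(\theta)-bg(\theta)$; $\mu_2(\theta+\omega)=a(\mu_2(\theta)-\delta)+bg(\theta)$; $\mu_3(\theta+\omega)=a\mu_3(\theta)+bg(\theta)$; $\mu_4(\theta+\omega)=a\mu_4(\theta)-bg(\theta)$. Also $\hat\mu_2$ is the continuous solution of $\hat\mu_2(\theta+\omega)=a(\hat\mu_2(\theta)+\delta)+bg(\theta)$ and $\tilde\gamma_1(\theta)=-\frac\pi2-bg(\theta-\omega)$. The initial curve $\varphi_0$ is: $\frac\pi2-bg(\theta-\omega)$ for $i=1$; $bg(\theta-\omega)$ for $i=2$; $-1+bg(\theta-\omega)$ for $i=3$; $1-bg(\theta-\omega)$ for $i=4$. For $n\ge0$, $\varphi_{n+1}=\mathcal F_i(\varphi_n)$ if $i=1,2,3$ and $\varphi_{n+1}=\mathcal F_4^2(\varphi_n)$ if $i=4$. The curve $\varphi_\infty$ is the pointwise limit of $\varphi_n$; for $b>b^*(a)$ the statement concerns the cases in which this limit exists as a real-valued curve. A curve is called piecewise $C^{1+\tau}$ if it is continuous and there are finitely many functions $p_1,\dots,p_k\in C^{1+\tau}(\mathbb T)$ such that at every $\theta\in\mathbb T$ its value is one of $p_1(\theta),\dots,p_k(\theta)$. As usual, $C^{1+\tau}$ refers to Hölder regularity of exponent $1+\tau$. Bifurcation value. $b^*(a)$ (assumed to exist) is the smallest $b>0$ for which the following graphs meet: for $i=1$, the graph of $\mu_1$ and the graph of $\varphi_0$ or of $\tilde\gamma_1$;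 for $i=2$, the graph of $\varphi_0$ and the graph of $\mu_2$ or of $\hat\mu_2$; for $i=3,4$, the graphs of $\varphi_0$ and $\mu_i$.
   Formalization: For i=2 and 0<b<b*(a), existence of the pointwise limit φ_∞ is assumed, because the iterates φ_n can fail to converge there; for i=1,3,4 and 0<b<b*(a) its existence is proved. *)

theory Defs
  imports "HOL-Analysis.Analysis"
begin

text \<open>
  The circle is \<open>\<real>/2\<pi>\<int>\<close>; a function on it is represented by its \<open>2\<pi>\<close>-periodic lift
  \<open>real \<Rightarrow> real\<close>.
\<close>

definition on_circle :: "(real \<Rightarrow> real) \<Rightarrow> bool" where
  "on_circle f \<longleftrightarrow> (\<forall>\<theta>. f (\<theta> + 2 * pi) = f \<theta>)"

text \<open>
  Hoelder class \<open>C\<^sup>s\<close> on the circle, \<open>s \<ge> 0\<close>: with \<open>k = \<lfloor>s\<rfloor>\<close>, the function is \<open>k\<close> times continuously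
  differentiable and its \<open>k\<close>-th derivative is Hoelder continuous of exponent \<open>s - k \<in> [0, 1)\<close>.
  For integer \<open>s\<close> the last condition is void (a continuous periodic function is bounded), so the
  class is then the ordinary \<open>C\<^sup>k\<close>.  Here \<open>D j\<close> is the \<open>j\<close>-th derivative.
\<close>

definition holder_class :: "real \<Rightarrow> (real \<Rightarrow> real) set" where
  "holder_class s = {f. on_circle f \<and>
     (\<exists>D :: nat \<Rightarrow> real \<Rightarrow> real. \<exists>C.
        D 0 = f \<and>
        (\<forall>j < nat \<lfloor>s\<rfloor>. \<forall>\<theta>. (D j has_real_derivative D (Suc j) \<theta>) (at \<theta>)) \<and>
        continuous_on UNIV (D (nat \<lfloor>s\<rfloor>)) \<and>
        (\<forall>\<theta> \<theta>'. \<bar>D (nat \<lfloor>s\<rfloor>) \<theta> - D (nat \<lfloor>s\<rfloor>) \<theta>'\<bar> \<le> C * \<bar>\<theta> - \<theta>'\<bar> powr frac s))}"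

definition piecewise_holder :: "real \<Rightarrow> (real \<Rightarrow> real) \<Rightarrow> bool" where
  "piecewise_holder s f \<longleftrightarrow> on_circle f \<and> continuous_on UNIV f \<and>
     (\<exists>P. finite P \<and> P \<subseteq> holder_class s \<and> (\<forall>\<theta>. \<exists>p\<in>P. f \<theta> = p \<theta>))"

text \<open>
  The four families.  Throughout, the index \<open>i\<close> is meant to range over \<open>{1, 2, 3, 4}\<close>; any other
  value falls into the last branch of a conditional.
\<close>

definition h1 :: "real \<Rightarrow> real \<Rightarrow> real" where
  "h1 a x = (if x < - (pi / (2 * a)) then - (pi / 2)
             else if x \<le> pi / (2 * a) then a * x else pi / 2)"

definition h2 :: "real \<Rightarrow> real \<Rightarrow> real \<Rightarrow> real" where
  "h2 a \<delta> x = (if x < - \<delta> then a * (x + \<delta>) else if x \<le> \<delta> then 0 else a * (x - \<delta>))"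

definition h3 :: "real \<Rightarrow> real \<Rightarrow> real" where
  "h3 a x = (if x > - (1 / a) then a * x else - 1)"

definition h4 :: "real \<Rightarrow> real \<Rightarrow> real" where
  "h4 a x = (if x > 1 / a then a * x else 1)"

definition fibre_fun :: "nat \<Rightarrow> real \<Rightarrow> real \<Rightarrow> real \<Rightarrow> real" where
  "fibre_fun i a \<delta> = (if i = 1 then h1 a else if i = 2 then h2 a \<delta> else if i = 3 then h3 a else h4 a)"

definition forcing_sign :: "nat \<Rightarrow> real" where
  "forcing_sign i = (if i = 2 \<or> i = 3 then 1 else - 1)"

definition skew_map ::
    "nat \<Rightarrow> real \<Rightarrow> real \<Rightarrow> real \<Rightarrow> (real \<Rightarrow> real) \<Rightarrow> real \<Rightarrow> real \<times> real \<Rightarrow> real \<times> real" where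
  "skew_map i a \<delta> \<omega> g b = (\<lambda>(x, \<theta>). (fibre_fun i a \<delta> x + forcing_sign i * b * g \<theta>, \<theta> + \<omega>))"

definition graph_transform ::
    "nat \<Rightarrow> real \<Rightarrow> real \<Rightarrow> real \<Rightarrow> (real \<Rightarrow> real) \<Rightarrow> real \<Rightarrow> (real \<Rightarrow> real) \<Rightarrow> real \<Rightarrow> real" where
  "graph_transform i a \<delta> \<omega> g b \<phi> = (\<lambda>\<theta>. fst (skew_map i a \<delta> \<omega> g b (\<phi> (\<theta> - \<omega>), \<theta> - \<omega>)))"

text \<open>
  The continuous curve on the circle solving \<open>\<mu> (\<theta> + \<omega>) = R (\<mu> \<theta>) \<theta>\<close>.  In every use below \<open>R\<close> is
  affine in its first argument with slope \<open>a\<close>, \<open>\<bar>a\<bar> > 1\<close>, so that the solution exists and is unique.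
\<close>

definition invariant_curve :: "real \<Rightarrow> (real \<Rightarrow> real \<Rightarrow> real) \<Rightarrow> real \<Rightarrow> real" where
  "invariant_curve \<omega> R =
     (THE \<mu>. on_circle \<mu> \<and> continuous_on UNIV \<mu> \<and> (\<forall>\<theta>. \<mu> (\<theta> + \<omega>) = R (\<mu> \<theta>) \<theta>))"

definition mu_curve :: "nat \<Rightarrow> real \<Rightarrow> real \<Rightarrow> real \<Rightarrow> (real \<Rightarrow> real) \<Rightarrow> real \<Rightarrow> real \<Rightarrow> real" where
  "mu_curve i a \<delta> \<omega> g b =
     (if i = 1 then invariant_curve \<omega> (\<lambda>x \<theta>. a * x - b * g \<theta>)
      else if i = 2 then invariant_curve \<omega> (\<lambda>x \<theta>. a * (x - \<delta>) + b * g \<theta>)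
      else if i = 3 then invariant_curve \<omega> (\<lambda>x \<theta>. a * x + b * g \<theta>)
      else invariant_curve \<omega> (\<lambda>x \<theta>. a * x - b * g \<theta>))"

definition mu_hat2 :: "real \<Rightarrow> real \<Rightarrow> real \<Rightarrow> (real \<Rightarrow> real) \<Rightarrow> real \<Rightarrow> real \<Rightarrow> real" where
  "mu_hat2 a \<delta> \<omega> g b = invariant_curve \<omega> (\<lambda>x \<theta>. a * (x + \<delta>) + b * g \<theta>)"

definition gamma_tilde1 :: "real \<Rightarrow> (real \<Rightarrow> real) \<Rightarrow> real \<Rightarrow> real \<Rightarrow> real" where
  "gamma_tilde1 \<omega> g b = (\<lambda>\<theta>. - (pi / 2) - b * g (\<theta> - \<omega>))"

definition initial_curve :: "nat \<Rightarrow> real \<Rightarrow> (real \<Rightarrow> real) \<Rightarrow> real \<Rightarrow> real \<Rightarrow> real" where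
  "initial_curve i \<omega> g b = (\<lambda>\<theta>.
     if i = 1 then pi / 2 - b * g (\<theta> - \<omega>)
     else if i = 2 then b * g (\<theta> - \<omega>)
     else if i = 3 then - 1 + b * g (\<theta> - \<omega>)
     else 1 - b * g (\<theta> - \<omega>))"

primrec iterated_curve ::
    "nat \<Rightarrow> real \<Rightarrow> real \<Rightarrow> real \<Rightarrow> (real \<Rightarrow> real) \<Rightarrow> real \<Rightarrow> nat \<Rightarrow> real \<Rightarrow> real" where
  "iterated_curve i a \<delta> \<omega> g b 0 = initial_curve i \<omega> g b"
| "iterated_curve i a \<delta> \<omega> g b (Suc n) =
     (if i = 4
      then graph_transform i a \<delta> \<omega> g b (graph_transform i a \<delta> \<omega> g b (iterated_curve i a \<delta> \<omega> g b n))
      else graph_transform i a \<delta> \<omega> g b (iterated_curve i a \<delta> \<omega> g b n))"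

definition graphs_meet :: "(real \<Rightarrow> real) \<Rightarrow> (real \<Rightarrow> real) \<Rightarrow> bool" where
  "graphs_meet \<phi> \<psi> \<longleftrightarrow> (\<exists>\<theta>. \<phi> \<theta> = \<psi> \<theta>)"

definition collision :: "nat \<Rightarrow> real \<Rightarrow> real \<Rightarrow> real \<Rightarrow> (real \<Rightarrow> real) \<Rightarrow> real \<Rightarrow> bool" where
  "collision i a \<delta> \<omega> g b \<longleftrightarrow>
     (if i = 1 then
        graphs_meet (mu_curve i a \<delta> \<omega> g b) (initial_curve i \<omega> g b) \<or>
        graphs_meet (mu_curve i a \<delta> \<omega> g b) (gamma_tilde1 \<omega> g b)
      else if i = 2 then
        graphs_meet (initial_curve i \<omega> g b) (mu_curve i a \<delta> \<omega> g b) \<or>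
        graphs_meet (initial_curve i \<omega> g b) (mu_hat2 a \<delta> \<omega> g b)
      else graphs_meet (initial_curve i \<omega> g b) (mu_curve i a \<delta> \<omega> g b))"

definition is_bifurcation_value ::
    "nat \<Rightarrow> real \<Rightarrow> real \<Rightarrow> real \<Rightarrow> (real \<Rightarrow> real) \<Rightarrow> real \<Rightarrow> bool" where
  "is_bifurcation_value i a \<delta> \<omega> g b\<^sub>0 \<longleftrightarrow>
     b\<^sub>0 > 0 \<and> collision i a \<delta> \<omega> g b\<^sub>0 \<and> (\<forall>b > 0. collision i a \<delta> \<omega> g b \<longrightarrow> b\<^sub>0 \<le> b)"

end

(*
  Each map collapses an interval of a fibre to a point and expands by |a| elsewhere, and the curve mu
  is the repelling fixed curve of an expanding affine branch.  Where phi_N and phi_(N+1) differ, no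
  collapse has taken place along the last N steps, so the distance to mu has grown like |a|^N from the
  last place where it was bounded below.  Below b* such a lower bound holds for phi_0 everywhere;
  above b* it holds over some arc, which every orbit of the rotation visits within a bounded time.
  Since all curves are bounded, phi_N = phi_(N+1) for some N, and phi_N is piecewise C^(1+tau) because
  it arises from phi_0 in finitely many steps.  (For i = 2, 3 and b > b* the iterates are unbounded at
  every point, so there the limit does not exist.)

  For i = 2 and b < b* there is no monotonicity in n, and the argument needs pointwise convergence.
  By Baire the set R of points of locally uniform convergence is dense.  If the limit L enters
  |x| < delta at a point of R, then all phi_n lie in the collapsed zone over a common arc, and the
  previous argument applies.  Otherwise R splits into {L >= delta} and {L <= -delta}.  Both are
  nonempty, since L cannot follow a single expanding branch forever.  At a boundary point x of the two
  parts, comparing phi_n with L along the backward orbit of x gives phi_n(x) <= -delta for infinitely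
  many n and phi_n(x) >= delta for infinitely many n, contradicting convergence at x.
*)

theory Submission
  imports Defs
begin

section \<open>Periodic functions and compactness of the circle\<close>

lemma on_circle_int:
  assumes "on_circle f"
  shows "f (x + 2 * pi * of_int m) = f x"
proof -
  interpret periodic_fun_simple f "2 * pi"
    using assms by unfold_locales (simp add: on_circle_def)
  show ?thesis
    using plus_of_int[of x m] by (simp add: mult.commute)
qed

lemma on_circle_reduce:
  assumes "on_circle f"
  obtains y where "0 \<le> y" "y \<le> 2 * pi" "f x = f y"
proof
  define m where "m = \<lfloor>x / (2 * pi)\<rfloor>"
  define y where "y = x - 2 * pi * of_int m"
  have "of_int m \<le> x / (2 * pi)" "x / (2 * pi) < of_int m + 1"
    unfolding m_def by linarith+
  then show "0 \<le> y" "y \<le> 2 * pi"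
    by (simp_all add: y_def field_simps)
  show "f x = f y"
    using on_circle_int[OF assms, of y m] by (simp add: y_def)
qed

lemma on_circle_range:
  assumes "on_circle f"
  shows "range f = f ` {0..2 * pi}"
proof
  show "range f \<subseteq> f ` {0..2 * pi}"
  proof
    fix v
    assume "v \<in> range f"
    then obtain x where "v = f x" by blast
    moreover obtain y where "0 \<le> y" "y \<le> 2 * pi" "f x = f y"
      using on_circle_reduce[OF assms] .
    ultimately show "v \<in> f ` {0..2 * pi}"
      by auto
  qed
qed auto

lemma on_circle_bounded:
  assumes "on_circle f" "continuous_on UNIV f"
  obtains B where "B > 0" "\<And>x. \<bar>f x\<bar> \<le> B"
proof -
  have "compact (range f)"
    unfolding on_circle_range[OF assms(1)]
    using assms(2) by (intro compact_continuous_image) (auto intro: continuous_on_subset)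
  then have "bounded (range f)"
    by (rule compact_imp_bounded)
  then show thesis
    using that by (auto simp: bounded_pos)
qed

text \<open>Compactness upgrades a pointwise strict bound to a uniform margin; this is the initial
  separation that expansion later amplifies.\<close>

lemma on_circle_less_uniform:
  assumes "on_circle f" "continuous_on UNIV f" "\<And>x. f x < A"
  obtains c where "c > 0" "\<And>x. f x \<le> A - c"
proof -
  have "compact (range f)"
    unfolding on_circle_range[OF assms(1)]
    using assms(2) by (intro compact_continuous_image) (auto intro: continuous_on_subset)
  then obtain x where "\<And>y. f y \<le> f x"
    using compact_attains_sup[of "range f"] by auto
  then show thesis
    using that[of "A - f x"] assms(3)[of x] by auto
qed

section \<open>Closure properties of Hoelder and piecewise Hoelder functions\<close>

text \<open>On one affine branch of a fibre map the graph transform has exactly this form: a slope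
  times the rotated curve, the rotated forcing, and an offset.\<close>

lemma holder_class_affine:
  assumes "f \<in> holder_class s" "g \<in> holder_class s"
  shows "(\<lambda>\<theta>. \<alpha> * f (\<theta> - \<omega>) + \<beta> * g (\<theta> - \<omega>) + \<gamma>) \<in> holder_class s"
proof -
  define k where "k = nat \<lfloor>s\<rfloor>"
  obtain Df Cf where f: "on_circle f" "Df 0 = f"
      "\<And>j \<theta>. j < k \<Longrightarrow> (Df j has_real_derivative Df (Suc j) \<theta>) (at \<theta>)"
      "continuous_on UNIV (Df k)"
      "\<And>\<theta> \<theta>'. \<bar>Df k \<theta> - Df k \<theta>'\<bar> \<le> Cf * \<bar>\<theta> - \<theta>'\<bar> powr frac s"
    using assms(1) unfolding holder_class_def k_def by blast
  obtain Dg Cg where g: "on_circle g" "Dg 0 = g"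
      "\<And>j \<theta>. j < k \<Longrightarrow> (Dg j has_real_derivative Dg (Suc j) \<theta>) (at \<theta>)"
      "continuous_on UNIV (Dg k)"
      "\<And>\<theta> \<theta>'. \<bar>Dg k \<theta> - Dg k \<theta>'\<bar> \<le> Cg * \<bar>\<theta> - \<theta>'\<bar> powr frac s"
    using assms(2) unfolding holder_class_def k_def by blast
  define D where "D j \<theta> = \<alpha> * Df j (\<theta> - \<omega>) + \<beta> * Dg j (\<theta> - \<omega>) + (if j = 0 then \<gamma> else 0)"
    for j :: nat and \<theta> :: real
  have shift: "((\<lambda>x. p (x - \<omega>)) has_real_derivative d) (at \<theta>)"
    if "(p has_real_derivative d) (at (\<theta> - \<omega>))" for p d \<theta>
    using DERIV_shift[of p d \<theta> "- \<omega>"] that by simp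
  have "on_circle (\<lambda>\<theta>. \<alpha> * f (\<theta> - \<omega>) + \<beta> * g (\<theta> - \<omega>) + \<gamma>)"
    using f(1) g(1) by (simp add: on_circle_def diff_add_eq[symmetric])
  moreover have "D 0 = (\<lambda>\<theta>. \<alpha> * f (\<theta> - \<omega>) + \<beta> * g (\<theta> - \<omega>) + \<gamma>)"
    by (simp add: D_def fun_eq_iff f(2) g(2))
  moreover have "(D j has_real_derivative D (Suc j) \<theta>) (at \<theta>)" if "j < k" for j \<theta>
  proof -
    have "((\<lambda>\<theta>. \<alpha> * Df j (\<theta> - \<omega>) + \<beta> * Dg j (\<theta> - \<omega>) + (if j = 0 then \<gamma> else 0))
        has_real_derivative \<alpha> * Df (Suc j) (\<theta> - \<omega>) + \<beta> * Dg (Suc j) (\<theta> - \<omega>) + 0) (at \<theta>)"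
      by (intro DERIV_add DERIV_cmult DERIV_const shift f(3) g(3) that)
    then show ?thesis
      by (simp add: D_def[abs_def])
  qed
  moreover have "continuous_on UNIV (D k)"
    unfolding D_def
    by (intro continuous_intros continuous_on_compose2[OF f(4)] continuous_on_compose2[OF g(4)]) auto
  moreover have "\<bar>D k \<theta> - D k \<theta>'\<bar> \<le> (\<bar>\<alpha>\<bar> * Cf + \<bar>\<beta>\<bar> * Cg) * \<bar>\<theta> - \<theta>'\<bar> powr frac s" for \<theta> \<theta>'
  proof -
    have "\<bar>D k \<theta> - D k \<theta>'\<bar>
        \<le> \<bar>\<alpha>\<bar> * \<bar>Df k (\<theta> - \<omega>) - Df k (\<theta>' - \<omega>)\<bar> + \<bar>\<beta>\<bar> * \<bar>Dg k (\<theta> - \<omega>) - Dg k (\<theta>' - \<omega>)\<bar>"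
      unfolding abs_mult[symmetric]
      by (rule order_trans[OF _ abs_triangle_ineq]) (simp add: D_def right_diff_distrib)
    also have "\<dots> \<le> \<bar>\<alpha>\<bar> * (Cf * \<bar>\<theta> - \<theta>'\<bar> powr frac s) + \<bar>\<beta>\<bar> * (Cg * \<bar>\<theta> - \<theta>'\<bar> powr frac s)"
      using f(5)[of "\<theta> - \<omega>" "\<theta>' - \<omega>"] g(5)[of "\<theta> - \<omega>" "\<theta>' - \<omega>"]
      by (intro add_mono mult_left_mono) auto
    finally show ?thesis
      by (simp add: algebra_simps)
  qed
  ultimately show ?thesis
    unfolding holder_class_def k_def mem_Collect_eq by blast
qed

lemma holder_class_on_circle: "f \<in> holder_class s \<Longrightarrow> on_circle f"
  by (simp add: holder_class_def)

lemma holder_class_continuous: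
  assumes "f \<in> holder_class s"
  shows "continuous_on UNIV f"
proof -
  obtain D where D: "D 0 = f" "continuous_on UNIV (D (nat \<lfloor>s\<rfloor>))"
      "\<And>j \<theta>. j < nat \<lfloor>s\<rfloor> \<Longrightarrow> (D j has_real_derivative D (Suc j) \<theta>) (at \<theta>)"
    using assms unfolding holder_class_def by blast
  show ?thesis
  proof (cases "nat \<lfloor>s\<rfloor>")
    case 0
    then show ?thesis using D by simp
  next
    case (Suc k)
    then show ?thesis
      using D(1) D(3)[of 0] by (auto intro!: DERIV_continuous_on)
  qed
qed

text \<open>New pieces are indexed by a piece of \<open>f\<close> and an affine branch of
  \<open>h\<close>, so their number stays finite; continuity of \<open>h\<close> takes care of the
  breakpoints.\<close>

lemma piecewise_holder_image:
  assumes f: "piecewise_holder s f" and g: "g \<in> holder_class s"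
    and h: "continuous_on UNIV h" and A: "finite A" "\<And>x. \<exists>(\<alpha>, \<gamma>)\<in>A. h x = \<alpha> * x + \<gamma>"
  shows "piecewise_holder s (\<lambda>\<theta>. h (f (\<theta> - \<omega>)) + \<beta> * g (\<theta> - \<omega>))"
proof -
  obtain P where P: "finite P" "P \<subseteq> holder_class s" "\<And>\<theta>. \<exists>p\<in>P. f \<theta> = p \<theta>"
    and fc: "on_circle f" "continuous_on UNIV f"
    using f unfolding piecewise_holder_def by blast
  define Q where "Q = (\<lambda>(p, \<alpha>, \<gamma>) \<theta>. \<alpha> * p (\<theta> - \<omega>) + \<beta> * g (\<theta> - \<omega>) + \<gamma>) ` (P \<times> A)"
  have "on_circle (\<lambda>\<theta>. h (f (\<theta> - \<omega>)) + \<beta> * g (\<theta> - \<omega>))"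
    using fc(1) holder_class_on_circle[OF g]
    by (simp add: on_circle_def diff_add_eq[symmetric])
  moreover have "continuous_on UNIV (\<lambda>\<theta>. h (f (\<theta> - \<omega>)) + \<beta> * g (\<theta> - \<omega>))"
    by (intro continuous_intros continuous_on_compose2[OF h] continuous_on_compose2[OF fc(2)]
        continuous_on_compose2[OF holder_class_continuous[OF g]]) auto
  moreover have "finite Q" "Q \<subseteq> holder_class s"
    using P A(1) holder_class_affine[OF _ g] by (auto simp: Q_def)
  moreover have "\<exists>q\<in>Q. h (f (\<theta> - \<omega>)) + \<beta> * g (\<theta> - \<omega>) = q \<theta>" for \<theta>
  proof -
    obtain p where p: "p \<in> P" "f (\<theta> - \<omega>) = p (\<theta> - \<omega>)"
      using P(3) by blast
    obtain \<alpha> \<gamma> where "(\<alpha>, \<gamma>) \<in> A" "h (f (\<theta> - \<omega>)) = \<alpha> * f (\<theta> - \<omega>) + \<gamma>"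
      using A(2) by blast
    with p show ?thesis
      unfolding Q_def by (intro bexI[of _ "\<lambda>\<theta>. \<alpha> * p (\<theta> - \<omega>) + \<beta> * g (\<theta> - \<omega>) + \<gamma>"]) force+
  qed
  ultimately show ?thesis
    unfolding piecewise_holder_def by blast
qed

section \<open>Recurrence of irrational rotations\<close>

text \<open>Kronecker's density theorem for \<open>\<omega> / (2 * pi)\<close>, scaled back by the
  period; the integer \<open>m\<close> removes whole turns.\<close>

lemma rotation_dense:
  assumes "\<omega> \<notin> (\<lambda>q. 2 * pi * q) ` \<rat>" "e > 0"
  obtains j :: nat and m :: int where "\<bar>\<theta> + real j * \<omega> + 2 * pi * of_int m - \<theta>0\<bar> < e"
proof -
  have "\<omega> / (2 * pi) \<notin> \<rat>"
    using assms(1) by (auto simp: image_iff dest!: bspec[of _ _ "\<omega> / (2 * pi)"])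
  then obtain h k :: int where hk: "k > 0"
      "\<bar>of_int k * (\<omega> / (2 * pi)) - of_int h - (\<theta>0 - \<theta>) / (2 * pi)\<bar> < e / (2 * pi)"
    using sequence_of_fractional_parts_is_dense[of "\<omega> / (2 * pi)" "e / (2 * pi)" "(\<theta>0 - \<theta>) / (2 * pi)"]
      assms(2) by (metis divide_pos_pos pi_gt_zero mult_pos_pos zero_less_numeral)
  have "\<theta> + real (nat k) * \<omega> + 2 * pi * of_int (- h) - \<theta>0
      = 2 * pi * (of_int k * (\<omega> / (2 * pi)) - of_int h - (\<theta>0 - \<theta>) / (2 * pi))"
    using hk(1) by (simp add: field_simps)
  also have "\<bar>\<dots>\<bar> < e"
    using hk(2) by (simp add: abs_mult pos_less_divide_eq mult.commute)
  finally show thesis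
    by (rule that)
qed

text \<open>A subset of the circle is represented by a \<open>2\<pi>\<close>-invariant subset of the line.\<close>

lemma rotation_return:
  assumes \<omega>: "\<omega> \<notin> (\<lambda>q. 2 * pi * q) ` \<rat>"
    and W: "open W" "W \<noteq> {}" "\<And>x. x + 2 * pi \<in> W \<longleftrightarrow> x \<in> W"
  obtains N where "\<And>\<theta>. \<exists>j\<le>N. \<theta> + real j * \<omega> \<in> W"
proof -
  obtain \<theta>0 e where e: "e > 0" "ball \<theta>0 e \<subseteq> W"
    using W(1,2) openE by blast
  have per: "x + 2 * pi * of_int m \<in> W \<longleftrightarrow> x \<in> W" for x m
  proof -
    interpret periodic_fun_simple "\<lambda>x. x \<in> W" "2 * pi"
      using W(3) by unfold_locales simp
    show ?thesis
      using plus_of_int[of x m] by (simp add: mult.commute)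
  qed
  define V where "V j = (\<lambda>\<theta>. \<theta> + real j * \<omega>) -` W" for j
  have op: "open (V j)" for j
    unfolding V_def by (intro open_vimage W(1) continuous_intros)
  have cover: "\<exists>j. \<theta> \<in> V j" for \<theta>
  proof -
    obtain j :: nat and m :: int where "\<bar>\<theta> + real j * \<omega> + 2 * pi * of_int m - \<theta>0\<bar> < e"
      using rotation_dense[OF \<omega> e(1)] .
    then have "\<theta> + real j * \<omega> + 2 * pi * of_int m \<in> W"
      using e(2) by (auto simp: dist_real_def subset_iff)
    then show ?thesis
      using per by (auto simp: V_def)
  qed
  \<comment> \<open>Compactness of one period turns individual visiting times into a common
    bound.\<close>
  have "compact {0..2 * pi}" "{0..2 * pi} \<subseteq> (\<Union>j\<in>UNIV. V j)"
    using cover by auto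
  then obtain J where J: "finite J" "{0..2 * pi} \<subseteq> (\<Union>j\<in>J. V j)"
    using compactE_image[of "{0..2 * pi}" UNIV V] op by metis
  have "\<exists>j\<le>Max (insert 0 J). \<theta> + real j * \<omega> \<in> W" for \<theta>
  proof -
    define m where "m = \<lfloor>\<theta> / (2 * pi)\<rfloor>"
    have "of_int m \<le> \<theta> / (2 * pi)" "\<theta> / (2 * pi) < of_int m + 1"
      unfolding m_def by linarith+
    then have "\<theta> - 2 * pi * of_int m \<in> {0..2 * pi}"
      by (simp add: field_simps)
    then obtain j where j: "j \<in> J" "\<theta> - 2 * pi * of_int m \<in> V j"
      using J(2) by blast
    then have "\<theta> + real j * \<omega> \<in> W"
      using per[of "\<theta> - 2 * pi * of_int m + real j * \<omega>" m] by (simp add: V_def algebra_simps)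
    with j(1) J(1) show ?thesis
      by (intro exI[of _ j]) auto
  qed
  then show thesis
    using that by blast
qed

lemma irrational_rotation_uminus:
  "\<omega> \<notin> (\<lambda>q. 2 * pi * q) ` \<rat> \<Longrightarrow> - \<omega> \<notin> (\<lambda>q. 2 * pi * q) ` \<rat>"
proof (rule contrapos_nn)
  assume "- \<omega> \<in> (\<lambda>q. 2 * pi * q) ` \<rat>"
  then obtain q where "q \<in> \<rat>" "- \<omega> = 2 * pi * q" by blast
  then have "- q \<in> \<rat>" "\<omega> = 2 * pi * (- q)" by auto
  then show "\<omega> \<in> (\<lambda>q. 2 * pi * q) ` \<rat>" by blast
qed

text \<open>For \<open>i = 4\<close> the curves are iterated by the square of the graph transform,
  which rotates the base by \<open>2 * \<omega>\<close>.\<close>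

lemma irrational_rotation_double:
  assumes "\<omega> \<notin> (\<lambda>q. 2 * pi * q) ` \<rat>"
  shows "2 * \<omega> \<notin> (\<lambda>q. 2 * pi * q) ` \<rat>"
proof
  assume "2 * \<omega> \<in> (\<lambda>q. 2 * pi * q) ` \<rat>"
  then obtain q where "q \<in> \<rat>" "2 * \<omega> = 2 * pi * q" by blast
  then have "q / 2 \<in> \<rat>" "\<omega> = 2 * pi * (q / 2)" by auto
  with assms show False by blast
qed

section \<open>Invariant curves of expanding affine maps\<close>

text \<open>Solved by \<open>- \<Sum>k. r (\<theta> + k \<omega>) / a ^ (k + 1)\<close>.\<close>

lemma affine_invariant_curve:
  fixes a :: real
  assumes a: "\<bar>a\<bar> > 1" and r: "on_circle r" "continuous_on UNIV r"
  shows "\<exists>!\<mu>. on_circle \<mu> \<and> continuous_on UNIV \<mu> \<and> (\<forall>\<theta>. \<mu> (\<theta> + \<omega>) = a * \<mu> \<theta> + r \<theta>)"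
proof (rule ex_ex1I)
  obtain B where B: "B > 0" "\<And>x. \<bar>r x\<bar> \<le> B"
    using on_circle_bounded[OF r] by blast
  define t where "t k \<theta> = r (\<theta> + real k * \<omega>) / a ^ Suc k" for k \<theta>
  define \<mu> where "\<mu> \<theta> = - (\<Sum>k. t k \<theta>)" for \<theta>
  have bd: "norm (t k \<theta>) \<le> B * (1 / \<bar>a\<bar>) ^ k" for k \<theta>
  proof -
    have "norm (t k \<theta>) \<le> B / \<bar>a\<bar> ^ Suc k"
      unfolding t_def using B(2) by (simp add: power_abs abs_mult divide_right_mono)
    also have "\<dots> \<le> B / \<bar>a\<bar> ^ k"
      using a B(1) by (intro divide_left_mono power_increasing) auto
    finally show ?thesis
      by (simp add: power_divide)
  qed
  have geo: "summable (\<lambda>k. B * (1 / \<bar>a\<bar>) ^ k)"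
    using a by (intro summable_mult summable_geometric) auto
  have sm: "summable (\<lambda>k. t k \<theta>)" for \<theta>
    by (rule summable_comparison_test'[OF geo]) (rule bd)
  have "uniform_limit UNIV (\<lambda>n \<theta>. \<Sum>k<n. t k \<theta>) (\<lambda>\<theta>. \<Sum>k. t k \<theta>) sequentially"
    by (rule Weierstrass_m_test[OF _ geo]) (rule bd)
  moreover have "continuous_on UNIV (\<lambda>\<theta>. \<Sum>k<n. t k \<theta>)" for n
    unfolding t_def
    by (intro continuous_intros continuous_on_compose2[OF r(2)]) (use a in auto)
  ultimately have "continuous_on UNIV (\<lambda>\<theta>. \<Sum>k. t k \<theta>)"
    by (intro uniform_limit_theorem) auto
  then have "continuous_on UNIV \<mu>"
    unfolding \<mu>_def by (intro continuous_intros)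
  moreover have "on_circle \<mu>"
  proof -
    have "t k (\<theta> + 2 * pi) = t k \<theta>" for k \<theta>
      using r(1)[unfolded on_circle_def, rule_format, of "\<theta> + real k * \<omega>"]
      by (simp add: t_def ac_simps)
    then show ?thesis
      by (simp add: on_circle_def \<mu>_def)
  qed
  moreover have "\<mu> (\<theta> + \<omega>) = a * \<mu> \<theta> + r \<theta>" for \<theta>
  proof -
    have "t k (\<theta> + \<omega>) = a * t (Suc k) \<theta>" for k
      using a by (simp add: t_def field_simps)
    then have "\<mu> (\<theta> + \<omega>) = - (\<Sum>k. a * t (Suc k) \<theta>)"
      by (simp add: \<mu>_def)
    also have "\<dots> = - (a * (\<Sum>k. t (Suc k) \<theta>))"
      using sm[of \<theta>] summable_Suc_iff[of "\<lambda>k. t k \<theta>"] by (subst suminf_mult) simp_all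
    also have "(\<Sum>k. t (Suc k) \<theta>) = (\<Sum>k. t k \<theta>) - t 0 \<theta>"
      using suminf_split_head[OF sm[of \<theta>]] by simp
    finally show ?thesis
      using a by (simp add: \<mu>_def t_def algebra_simps)
  qed
  ultimately show "\<exists>\<mu>. on_circle \<mu> \<and> continuous_on UNIV \<mu> \<and> (\<forall>\<theta>. \<mu> (\<theta> + \<omega>) = a * \<mu> \<theta> + r \<theta>)"
    by blast
next
  fix \<mu> \<nu>
  assume \<mu>: "on_circle \<mu> \<and> continuous_on UNIV \<mu> \<and> (\<forall>\<theta>. \<mu> (\<theta> + \<omega>) = a * \<mu> \<theta> + r \<theta>)"
    and \<nu>: "on_circle \<nu> \<and> continuous_on UNIV \<nu> \<and> (\<forall>\<theta>. \<nu> (\<theta> + \<omega>) = a * \<nu> \<theta> + r \<theta>)"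
  have "on_circle (\<lambda>\<theta>. \<mu> \<theta> - \<nu> \<theta>)" "continuous_on UNIV (\<lambda>\<theta>. \<mu> \<theta> - \<nu> \<theta>)"
    using \<mu> \<nu> by (auto simp: on_circle_def intro!: continuous_intros)
  then obtain B where B: "B > 0" "\<And>x. \<bar>\<mu> x - \<nu> x\<bar> \<le> B"
    by (rule on_circle_bounded) blast
  \<comment> \<open>Two solutions separate by the factor \<open>a\<close> in each step, which
    bounded functions can do only if they agree.\<close>
  have step: "\<mu> (\<theta> + real n * \<omega>) - \<nu> (\<theta> + real n * \<omega>) = a ^ n * (\<mu> \<theta> - \<nu> \<theta>)" for n \<theta>
  proof (induction n)
    case (Suc n)
    have "\<mu> (\<theta> + real n * \<omega> + \<omega>) - \<nu> (\<theta> + real n * \<omega> + \<omega>)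
        = a * (\<mu> (\<theta> + real n * \<omega>) - \<nu> (\<theta> + real n * \<omega>))"
      using \<mu> \<nu> by (simp add: right_diff_distrib)
    also have "\<theta> + real n * \<omega> + \<omega> = \<theta> + real (Suc n) * \<omega>"
      by (simp add: algebra_simps)
    finally show ?case
      using Suc by simp
  qed simp
  have "\<mu> \<theta> - \<nu> \<theta> = 0" for \<theta>
  proof (rule ccontr)
    assume "\<mu> \<theta> - \<nu> \<theta> \<noteq> 0"
    then have pos: "\<bar>\<mu> \<theta> - \<nu> \<theta>\<bar> > 0" by simp
    obtain n where "B / \<bar>\<mu> \<theta> - \<nu> \<theta>\<bar> < \<bar>a\<bar> ^ n"
      using real_arch_pow[OF a] by blast
    then have "B < \<bar>a ^ n * (\<mu> \<theta> - \<nu> \<theta>)\<bar>"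
      using pos by (simp add: divide_less_eq abs_mult power_abs)
    then show False
      using B(2)[of "\<theta> + real n * \<omega>"] step[of \<theta> n] by simp
  qed
  then show "\<mu> = \<nu>" by (simp add: fun_eq_iff)
qed

lemma invariant_curve_affine:
  fixes a :: real
  assumes "\<bar>a\<bar> > 1" "on_circle r" "continuous_on UNIV r" and R: "\<And>x \<theta>. R x \<theta> = a * x + r \<theta>"
    and \<mu>: "on_circle \<mu>" "continuous_on UNIV \<mu>" "\<And>\<theta>. \<mu> (\<theta> + \<omega>) = a * \<mu> \<theta> + r \<theta>"
  shows "invariant_curve \<omega> R = \<mu>"
proof -
  have "invariant_curve \<omega> R
      = (THE \<mu>. on_circle \<mu> \<and> continuous_on UNIV \<mu> \<and> (\<forall>\<theta>. \<mu> (\<theta> + \<omega>) = a * \<mu> \<theta> + r \<theta>))"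
    by (simp only: invariant_curve_def R)
  also have "\<dots> = \<mu>"
    by (rule the1_equality[OF affine_invariant_curve[OF assms(1-3)]]) (intro conjI allI \<mu>)
  finally show ?thesis .
qed

section \<open>Backward recurrence and the expansion argument\<close>

text \<open>The return bound for \<open>- \<omega>\<close> is applied after moving back
  \<open>m\<close> steps, which makes the visit as late as desired.\<close>

lemma rotation_frequently:
  assumes \<omega>: "\<omega> \<notin> (\<lambda>q. 2 * pi * q) ` \<rat>"
    and W: "open W" "W \<noteq> {}" "\<And>x. x + 2 * pi \<in> W \<longleftrightarrow> x \<in> W"
  shows "\<exists>n\<ge>m. \<theta> - real n * \<omega> \<in> W"
proof -
  obtain N where "\<And>\<theta>. \<exists>j\<le>N. \<theta> + real j * (- \<omega>) \<in> W"
    using rotation_return[OF irrational_rotation_uminus[OF \<omega>] W] by blast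
  then obtain j where "\<theta> - real m * \<omega> + real j * (- \<omega>) \<in> W"
    by blast
  then show ?thesis
    by (intro exI[of _ "m + j"]) (simp add: algebra_simps)
qed

text \<open>
  Where \<open>\<phi> N\<close> and \<open>\<phi> (Suc N)\<close> differ, none of the \<open>N\<close> preceding steps can have collapsed the two
  orbits, so all of them push at least one of the orbits away from \<open>\<mu>\<close> by the factor \<open>A\<close>.
\<close>

lemma eventually_stationary:
  fixes F :: "real \<Rightarrow> real \<Rightarrow> real" and \<phi> :: "nat \<Rightarrow> real \<Rightarrow> real"
  assumes step: "\<And>n \<theta>. \<phi> (Suc n) (\<theta> + \<omega>) = F \<theta> (\<phi> n \<theta>)"
    and mono: "\<And>\<theta>. mono (F \<theta>)"
    and exp: "\<And>\<theta> x y. x < y \<Longrightarrow> F \<theta> x \<noteq> F \<theta> y \<Longrightarrow>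
        A * (x - \<mu> \<theta>) \<le> F \<theta> x - \<mu> (\<theta> + \<omega>) \<and> F \<theta> y - \<mu> (\<theta> + \<omega>) \<le> A * (y - \<mu> \<theta>)"
    and A: "A > 1" and c: "c > 0"
    and bdd: "\<And>n \<theta>. \<bar>\<phi> n \<theta> - \<mu> \<theta>\<bar> \<le> B"
    and esc: "\<And>\<theta>. \<exists>k\<le>K.
        (\<forall>m\<in>{k, Suc k}. \<phi> m (\<theta> + real k * \<omega>) - \<mu> (\<theta> + real k * \<omega>) \<ge> c) \<or>
        (\<forall>m\<in>{k, Suc k}. \<phi> m (\<theta> + real k * \<omega>) - \<mu> (\<theta> + real k * \<omega>) \<le> - c)"
  shows "\<exists>N. \<phi> (Suc N) = \<phi> N"
proof -
  \<comment> \<open>\<open>L\<close> expanding steps carry a distance \<open>c\<close> beyond the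
    bound \<open>B\<close>; the first \<open>K\<close> steps are reserved for attaining that
    distance.\<close>
  obtain L where L: "B / c < A ^ L"
    using real_arch_pow[OF A] by blast
  define N where "N = K + L"
  have "\<phi> (Suc N) \<theta>0 = \<phi> N \<theta>0" for \<theta>0
  proof (rule ccontr)
    assume neq: "\<phi> (Suc N) \<theta>0 \<noteq> \<phi> N \<theta>0"
    \<comment> \<open>The backward orbit of \<open>\<theta>0\<close>, indexed so that
      \<open>z N = \<theta>0\<close>. Along it \<open>x\<close> and \<open>y\<close> are fibre
      orbits started from \<open>\<phi> 0\<close> and \<open>\<phi> (Suc 0)\<close> that end at the
      two values being compared.\<close>
    define z where "z k = \<theta>0 - real N * \<omega> + real k * \<omega>" for k
    define x where "x k = \<phi> k (z k)" for k
    define y where "y k = \<phi> (Suc k) (z k)" for k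
    have zS: "z (Suc k) = z k + \<omega>" for k
      by (simp add: z_def algebra_simps)
    have xS: "x (Suc k) = F (z k) (x k)" and yS: "y (Suc k) = F (z k) (y k)" for k
      by (simp_all add: x_def y_def zS step)
    \<comment> \<open>Orbits of the same fibre maps never separate once they meet, so the final
      difference excludes every earlier coincidence.\<close>
    have ne: "x k \<noteq> y k" if "k \<le> N" for k
    proof
      assume "x k = y k"
      with that have "x N = y N"
        by (induction N rule: dec_induct) (simp_all add: xS yS)
      then show False
        using neq by (simp add: x_def y_def z_def)
    qed
    \<comment> \<open>\<open>exp\<close> bounds the image of the lower point from below, and
      monotonicity of \<open>F\<close> passes the bound to the upper point; \<open>down\<close> is
      the mirror image.\<close>
    have up: "d \<le> x k - \<mu> (z k) \<Longrightarrow> d \<le> y k - \<mu> (z k) \<Longrightarrow> d \<ge> 0 \<Longrightarrow>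
        A * d \<le> x (Suc k) - \<mu> (z (Suc k)) \<and> A * d \<le> y (Suc k) - \<mu> (z (Suc k))" if "k < N" for k d
    proof -
      assume d: "d \<le> x k - \<mu> (z k)" "d \<le> y k - \<mu> (z k)" "d \<ge> 0"
      have *: "A * d \<le> F (z k) u - \<mu> (z k + \<omega>) \<and> A * d \<le> F (z k) v - \<mu> (z k + \<omega>)"
        if "u < v" "F (z k) u \<noteq> F (z k) v" "d \<le> u - \<mu> (z k)" for u v
      proof -
        have "A * d \<le> A * (u - \<mu> (z k))"
          using that(3) A by simp
        moreover have "F (z k) u \<le> F (z k) v"
          using mono that(1) by (simp add: monoD)
        ultimately show ?thesis
          using exp[OF that(1,2)] by linarith
      qed
      have "F (z k) (x k) \<noteq> F (z k) (y k)"
        using ne[of "Suc k"] that by (simp add: xS yS)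
      then show ?thesis
        using *[of "x k" "y k"] *[of "y k" "x k"] ne[of k] d that
        by (cases "x k" "y k" rule: linorder_cases) (simp_all add: xS yS zS)
    qed
    have down: "x k - \<mu> (z k) \<le> - d \<Longrightarrow> y k - \<mu> (z k) \<le> - d \<Longrightarrow> d \<ge> 0 \<Longrightarrow>
        x (Suc k) - \<mu> (z (Suc k)) \<le> - (A * d) \<and> y (Suc k) - \<mu> (z (Suc k)) \<le> - (A * d)" if "k < N" for k d
    proof -
      assume d: "x k - \<mu> (z k) \<le> - d" "y k - \<mu> (z k) \<le> - d" "d \<ge> 0"
      have *: "F (z k) u - \<mu> (z k + \<omega>) \<le> - (A * d) \<and> F (z k) v - \<mu> (z k + \<omega>) \<le> - (A * d)"
        if "u < v" "F (z k) u \<noteq> F (z k) v" "v - \<mu> (z k) \<le> - d" for u v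
      proof -
        have "A * (v - \<mu> (z k)) \<le> A * (- d)"
          using that(3) A by (intro mult_left_mono) auto
        moreover have "F (z k) u \<le> F (z k) v"
          using mono that(1) by (simp add: monoD)
        ultimately show ?thesis
          using exp[OF that(1,2)] by simp
      qed
      have "F (z k) (x k) \<noteq> F (z k) (y k)"
        using ne[of "Suc k"] that by (simp add: xS yS)
      then show ?thesis
        using *[of "x k" "y k"] *[of "y k" "x k"] ne[of k] d that
        by (cases "x k" "y k" rule: linorder_cases) (simp_all add: xS yS zS)
    qed
    obtain k where k: "k \<le> K"
      "(c \<le> x k - \<mu> (z k) \<and> c \<le> y k - \<mu> (z k)) \<or> (x k - \<mu> (z k) \<le> - c \<and> y k - \<mu> (z k) \<le> - c)"
      using esc[of "\<theta>0 - real N * \<omega>"] unfolding x_def y_def z_def by auto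
    have kL: "k + j \<le> N" if "j \<le> L" for j
      using k(1) that by (simp add: N_def)
    have "B < A ^ L * c"
      using L c by (simp add: pos_divide_less_eq)
    moreover have "\<bar>x (k + L) - \<mu> (z (k + L))\<bar> \<le> B"
      using bdd by (simp add: x_def)
    moreover have "\<bar>x (k + L) - \<mu> (z (k + L))\<bar> \<ge> A ^ L * c"
      using k(2)
    proof
      assume *: "c \<le> x k - \<mu> (z k) \<and> c \<le> y k - \<mu> (z k)"
      have "j \<le> L \<Longrightarrow> A ^ j * c \<le> x (k + j) - \<mu> (z (k + j)) \<and> A ^ j * c \<le> y (k + j) - \<mu> (z (k + j))" for j
      proof (induction j)
        case (Suc j)
        then show ?case
          using up[of "k + j" "A ^ j * c"] kL[of "Suc j"] A c by (simp add: mult.assoc)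
      qed (use * in simp)
      from this[of L] show ?thesis by linarith
    next
      assume *: "x k - \<mu> (z k) \<le> - c \<and> y k - \<mu> (z k) \<le> - c"
      have "j \<le> L \<Longrightarrow> x (k + j) - \<mu> (z (k + j)) \<le> - (A ^ j * c) \<and> y (k + j) - \<mu> (z (k + j)) \<le> - (A ^ j * c)" for j
      proof (induction j)
        case (Suc j)
        then show ?case
          using down[of "k + j" "A ^ j * c"] kL[of "Suc j"] A c by (simp add: mult.assoc)
      qed (use * in simp)
      from this[of L] show ?thesis by linarith
    qed
    ultimately show False by linarith
  qed
  then show ?thesis by blast
qed

text \<open>Over an arc around \<open>\<theta>0\<close> the initial values exceed a positive
  \<open>c\<close>. Every backward orbit meets this arc arbitrarily late, so the growth
  \<open>a ^ n * c\<close> reaches every \<open>\<theta>\<close>, not only those near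
  \<open>\<theta>0\<close>.\<close>

lemma expanding_orbit_unbounded:
  fixes u :: "nat \<Rightarrow> real \<Rightarrow> real"
  assumes \<omega>: "\<omega> \<notin> (\<lambda>q. 2 * pi * q) ` \<rat>" and a: "a > 1"
    and step: "\<And>n \<theta>. u (Suc n) (\<theta> + \<omega>) \<ge> a * u n \<theta>"
    and u0: "continuous_on UNIV (u 0)" "on_circle (u 0)" "u 0 \<theta>0 > 0"
  shows "\<exists>n. u n \<theta> > B"
proof -
  define c where "c = u 0 \<theta>0 / 2"
  define W where "W = {x. u 0 x > c}"
  have c: "c > 0" using u0(3) by (simp add: c_def)
  obtain m where m: "B / c < a ^ m"
    using real_arch_pow[OF a] by blast
  have "open W"
    unfolding W_def by (intro open_Collect_less u0(1) continuous_intros)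
  moreover have "\<theta>0 \<in> W" using u0(3) by (simp add: W_def c_def)
  moreover have "x + 2 * pi \<in> W \<longleftrightarrow> x \<in> W" for x
    using u0(2) by (simp add: W_def on_circle_def)
  ultimately obtain n where n: "n \<ge> m" "\<theta> - real n * \<omega> \<in> W"
    using rotation_frequently[OF \<omega>, of W m \<theta>] by blast
  have "u k (\<theta> - real n * \<omega> + real k * \<omega>) \<ge> a ^ k * c" for k
  proof (induction k)
    case 0
    then show ?case using n(2) by (simp add: W_def)
  next
    case (Suc k)
    have "a * (a ^ k * c) \<le> a * u k (\<theta> - real n * \<omega> + real k * \<omega>)"
      using Suc a by simp
    also have "\<dots> \<le> u (Suc k) (\<theta> - real n * \<omega> + real k * \<omega> + \<omega>)"
      by (rule step)
    also have "\<theta> - real n * \<omega> + real k * \<omega> + \<omega> = \<theta> - real n * \<omega> + real (Suc k) * \<omega>"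
      by (simp add: algebra_simps)
    finally show ?case by simp
  qed
  from this[of n] have "u n \<theta> \<ge> a ^ n * c" by simp
  moreover have "a ^ n * c \<ge> a ^ m * c"
    using a c n(1) by (intro mult_right_mono power_increasing) auto
  moreover have "B < a ^ m * c"
    using m c by (simp add: pos_divide_less_eq)
  ultimately have "u n \<theta> > B"
    by linarith
  then show ?thesis by blast
qed

section \<open>Locally uniform convergence and Baire category\<close>

text \<open>The double limit of \<open>f n z\<close> as \<open>z\<close> tends to \<open>x\<close>
  and \<open>n\<close> to infinity. Only the value \<open>L x\<close> enters, so no regularity of
  \<open>L\<close> near \<open>x\<close> is presupposed.\<close>

definition jointly_convergent_at ::
    "(nat \<Rightarrow> 'a::metric_space \<Rightarrow> 'b::metric_space) \<Rightarrow> ('a \<Rightarrow> 'b) \<Rightarrow> 'a \<Rightarrow> bool" where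
  "jointly_convergent_at f L x \<longleftrightarrow>
     (\<forall>e>0. \<exists>d>0. \<exists>N. \<forall>z n. dist z x < d \<longrightarrow> n \<ge> N \<longrightarrow> dist (f n z) (L x) < e)"

text \<open>For each \<open>m\<close>, pointwise convergence puts a point into some closed set
  \<open>E m N\<close>. A generic point avoids the frontiers of all these sets, so it is interior to
  the one containing it, and the tail is uniformly close to Cauchy nearby.\<close>

lemma jointly_convergent_dense:
  fixes f :: "nat \<Rightarrow> 'a::{real_normed_vector, heine_borel} \<Rightarrow> 'b::metric_space"
  assumes cont: "\<And>n. continuous_on UNIV (f n)" and lim: "\<And>x. (\<lambda>n. f n x) \<longlonglongrightarrow> L x"
  shows "closure {x. jointly_convergent_at f L x} = UNIV"
proof -
  define E where "E m N = (\<Inter>n\<in>{N..}. \<Inter>k\<in>{N..}. {x. dist (f n x) (f k x) \<le> 1 / real (Suc m)})"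
    for m N :: nat
  \<comment> \<open>The complement of \<open>G (m, N)\<close> is the frontier of a closed set, hence
    nowhere dense.\<close>
  define G where "G = (\<lambda>(m, N). interior (E m N) \<union> - E m N)"
  have clE: "closed (E m N)" for m N
    unfolding E_def by (intro closed_INT ballI closed_Collect_le continuous_intros cont)
  have "UNIV \<subseteq> closure (\<Inter>(range G))"
  proof (rule Baire)
    fix T assume "T \<in> range G"
    then obtain m N where T: "T = interior (E m N) \<union> - E m N"
      by (auto simp: G_def)
    have "open T"
      using clE unfolding T by (intro open_Un) auto
    moreover have "closure T = UNIV"
      using closure_subset[of "interior (E m N)"] by (auto simp: T closure_Un closure_complement)
    ultimately show "openin (top_of_set UNIV) T \<and> UNIV \<subseteq> closure T"
      by simp
  qed auto
  moreover have "\<Inter>(range G) \<subseteq> {x. jointly_convergent_at f L x}"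
  proof
    fix x assume x: "x \<in> \<Inter>(range G)"
    have "\<exists>d>0. \<exists>N. \<forall>z n. dist z x < d \<longrightarrow> n \<ge> N \<longrightarrow> dist (f n z) (L x) < e" if e: "e > 0" for e
    proof -
      obtain m where m: "1 / real (Suc m) < e / 3"
        using e nat_approx_posE[of "e / 3"] by auto
      \<comment> \<open>With half the tolerance, two tail values at \<open>x\<close> differ by at
        most \<open>1 / real (Suc m)\<close>, which is membership in \<open>E m N\<close>.\<close>
      obtain N where N: "\<And>n. n \<ge> N \<Longrightarrow> dist (f n x) (L x) < 1 / real (Suc m) / 2"
        using metric_LIMSEQ_D[OF lim[of x], of "1 / real (Suc m) / 2"] by auto
      have "dist (f n x) (f k x) \<le> 1 / real (Suc m)" if "n \<ge> N" "k \<ge> N" for n k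
        using dist_triangle_half_l[OF N[OF that(1)] N[OF that(2)]] by simp
      then have "x \<in> E m N"
        by (simp add: E_def)
      then have "x \<in> interior (E m N)"
        using x by (auto simp: G_def)
      then obtain d1 where d1: "d1 > 0" "ball x d1 \<subseteq> E m N"
        by (meson mem_interior)
      obtain d2 where d2: "d2 > 0" "\<And>z. dist z x < d2 \<Longrightarrow> dist (f N z) (f N x) < e / 3"
        using cont[of N] e unfolding continuous_on_iff by (metis UNIV_I divide_pos_pos zero_less_numeral)
      \<comment> \<open>Three moves of length below \<open>e / 3\<close>: from \<open>f n z\<close>
        to \<open>f N z\<close>, to \<open>f N x\<close>, to \<open>L x\<close>.\<close>
      have "dist (f n z) (L x) < e" if z: "dist z x < min d1 d2" and n: "n \<ge> N" for z n
      proof -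
        have "z \<in> E m N"
          using d1(2) z by (auto simp: dist_commute)
        then have "dist (f n z) (f N z) \<le> 1 / real (Suc m)"
          using n by (simp add: E_def)
        moreover have "dist (f N z) (f N x) < e / 3"
          using d2(2) z by simp
        moreover have "dist (f N x) (L x) < 1 / real (Suc m)"
          using N[of N] by (rule less_le_trans) (auto simp: field_simps)
        moreover have "dist (f n z) (L x) \<le> dist (f n z) (f N z) + dist (f N z) (f N x) + dist (f N x) (L x)"
          using dist_triangle[of "f n z" "L x" "f N z"] dist_triangle[of "f N z" "L x" "f N x"] by linarith
        ultimately show ?thesis
          using m by linarith
      qed
      then show ?thesis
        using d1(1) d2(1) by (intro exI[of _ "min d1 d2"]) auto
    qed
    then show "x \<in> {x. jointly_convergent_at f L x}"
      by (simp add: jointly_convergent_at_def)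
  qed
  ultimately show ?thesis
    using closure_mono by blast
qed

section \<open>Limits that avoid the interior of the collapsed zone\<close>

text \<open>
  \<open>R\<close> stands for the set of points of joint convergence of \<open>f\<close>, and \<open>R_outer\<close> is the situation to be
  excluded: the limit never enters the interior of the zone on which \<open>h\<close> vanishes.
\<close>

locale dead_zone =
  fixes \<omega> \<delta> :: real and h r :: "real \<Rightarrow> real" and f :: "nat \<Rightarrow> real \<Rightarrow> real" and L :: "real \<Rightarrow> real"
    and R :: "real set"
  assumes irrational: "\<omega> \<notin> (\<lambda>q. 2 * pi * q) ` \<rat>"
    and \<delta>: "\<delta> > 0"
    and h_mono: "mono h" and h_zero: "\<And>x. \<bar>x\<bar> \<le> \<delta> \<Longrightarrow> h x = 0"
    and f_0: "\<And>\<theta>. f 0 (\<theta> + \<omega>) = r \<theta>"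
    and f_Suc: "\<And>n \<theta>. f (Suc n) (\<theta> + \<omega>) = h (f n \<theta>) + r \<theta>"
    and f_cont: "\<And>n. continuous_on UNIV (f n)"
    and L_step: "\<And>\<theta>. L (\<theta> + \<omega>) = h (L \<theta>) + r \<theta>"
    and L_per: "on_circle L"
    and R_dense: "closure R = UNIV"
    and R_step: "\<And>\<theta>. \<theta> \<in> R \<Longrightarrow> \<theta> + \<omega> \<in> R"
    and R_per: "\<And>\<theta>. \<theta> + 2 * pi \<in> R \<longleftrightarrow> \<theta> \<in> R"
    and R_outer: "\<And>\<theta>. \<theta> \<in> R \<Longrightarrow> \<bar>L \<theta>\<bar> \<ge> \<delta>"
    and R_local: "\<And>\<theta>. \<theta> \<in> R \<Longrightarrow> \<exists>d>0. \<forall>z\<in>R. dist z \<theta> < d \<longrightarrow> \<bar>L z - L \<theta>\<bar> \<le> \<delta>"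
begin

text \<open>It tests \<open>L\<close> only on \<open>R\<close>, but its own points may lie outside
  \<open>R\<close>; thus it is an open subset of the line, to which connectedness applies.\<close>

definition upper :: "real set" where
  "upper = {x. \<exists>d>0. \<forall>z\<in>R. dist z x < d \<longrightarrow> L z \<ge> \<delta>}"

lemma R_iterate: "\<theta> \<in> R \<Longrightarrow> \<theta> + real n * \<omega> \<in> R"
proof (induction n)
  case (Suc n)
  then have "\<theta> + real n * \<omega> + \<omega> \<in> R"
    by (intro R_step) simp
  then show ?case
    by (simp add: algebra_simps)
qed simp

text \<open>Near a point of \<open>R\<close> the limit varies by at most \<open>\<delta>\<close>,
  too little to cross from \<open>\<delta>\<close> to \<open>- \<delta>\<close>, and
  \<open>R_outer\<close> excludes the values in between.\<close>

lemma upperI: "\<theta> \<in> R \<Longrightarrow> L \<theta> \<ge> \<delta> \<Longrightarrow> \<theta> \<in> upper"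
proof -
  assume \<theta>: "\<theta> \<in> R" "L \<theta> \<ge> \<delta>"
  obtain d where d: "d > 0" "\<And>z. z \<in> R \<Longrightarrow> dist z \<theta> < d \<Longrightarrow> \<bar>L z - L \<theta>\<bar> \<le> \<delta>"
    using R_local[OF \<theta>(1)] by blast
  have "L z \<ge> \<delta>" if "z \<in> R" "dist z \<theta> < d" for z
    using d(2)[OF that] R_outer[OF that(1)] \<theta>(2) \<delta> by linarith
  with d(1) show ?thesis
    by (auto simp: upper_def)
qed

lemma open_upper: "open upper"
  unfolding open_dist
proof
  fix x assume "x \<in> upper"
  then obtain d where d: "d > 0" "\<And>z. z \<in> R \<Longrightarrow> dist z x < d \<Longrightarrow> L z \<ge> \<delta>"
    by (auto simp: upper_def)
  have "y \<in> upper" if "dist y x < d" for y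
  proof -
    have "dist z x < d" if "dist z y < d - dist y x" for z
      using that dist_triangle[of z x y] by linarith
    then show ?thesis
      unfolding upper_def using that d(2)
      by (intro CollectI exI[of _ "d - dist y x"]) auto
  qed
  with d(1) show "\<exists>e>0. \<forall>y. dist y x < e \<longrightarrow> y \<in> upper"
    by blast
qed

lemma upper_periodic: "x + 2 * pi \<in> upper \<longleftrightarrow> x \<in> upper"
proof
  assume "x + 2 * pi \<in> upper"
  then obtain d where d: "d > 0" "\<And>z. z \<in> R \<Longrightarrow> dist z (x + 2 * pi) < d \<Longrightarrow> L z \<ge> \<delta>"
    by (auto simp: upper_def)
  have "L z \<ge> \<delta>" if "z \<in> R" "dist z x < d" for z
    using d(2)[of "z + 2 * pi"] that R_per[of z] L_per by (simp add: on_circle_def)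
  with d(1) show "x \<in> upper"
    by (auto simp: upper_def)
next
  assume "x \<in> upper"
  then obtain d where d: "d > 0" "\<And>z. z \<in> R \<Longrightarrow> dist z x < d \<Longrightarrow> L z \<ge> \<delta>"
    by (auto simp: upper_def)
  have "L z \<ge> \<delta>" if "z \<in> R" "dist z (x + 2 * pi) < d" for z
    using d(2)[of "z - 2 * pi"] that R_per[of "z - 2 * pi"] L_per[unfolded on_circle_def, rule_format, of "z - 2 * pi"]
    by (simp add: dist_real_def algebra_simps)
  with d(1) show "x + 2 * pi \<in> upper"
    by (auto simp: upper_def)
qed

text \<open>As \<open>h\<close> vanishes at \<open>\<delta>\<close>, \<open>h (L w) \<ge> 0\<close>,
  while \<open>f 0\<close> at \<open>w + \<omega>\<close> is the image of height zero over
  \<open>w\<close>; this first step causes the shift \<open>Suc n\<close>. Monotonicity of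
  \<open>h\<close> then keeps the order.\<close>

lemma le_limit:
  assumes "L w \<ge> \<delta>"
  shows "f n (w + real (Suc n) * \<omega>) \<le> L (w + real (Suc n) * \<omega>)"
proof (induction n)
  case 0
  have "0 \<le> h (L w)"
    using monoD[OF h_mono assms] h_zero[of \<delta>] \<delta> by simp
  then show ?case
    by (simp add: f_0 L_step)
next
  case (Suc n)
  have "f (Suc n) (w + real (Suc n) * \<omega> + \<omega>) \<le> L (w + real (Suc n) * \<omega> + \<omega>)"
    using monoD[OF h_mono Suc] by (simp add: f_Suc L_step)
  then show ?case
    by (simp add: algebra_simps)
qed

text \<open>The backward orbit of \<open>x\<close> visits \<open>upper\<close> arbitrarily late. If
  \<open>f k x\<close> exceeded \<open>- \<delta>\<close>, so would \<open>f k\<close> near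
  \<open>x\<close>; but close to \<open>x\<close> the limit also takes values at most
  \<open>- \<delta>\<close>, and \<open>le_limit\<close> puts \<open>f k\<close> below such a value
  at a point coming from \<open>upper\<close>.\<close>

lemma frequently_below:
  assumes x: "x \<notin> upper" and ne: "upper \<noteq> {}"
  shows "\<exists>n\<ge>m. f n x \<le> - \<delta>"
proof -
  obtain n where n: "n \<ge> Suc m" "x - real n * \<omega> \<in> upper"
    using rotation_frequently[OF irrational open_upper ne upper_periodic] by blast
  obtain k where k: "n = Suc k" "k \<ge> m"
    using n(1) by (cases n) auto
  obtain d where d: "d > 0" "\<And>z. z \<in> R \<Longrightarrow> dist z (x - real n * \<omega>) < d \<Longrightarrow> L z \<ge> \<delta>"
    using n(2) by (auto simp: upper_def)
  have "f k x \<le> - \<delta>"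
  proof (rule ccontr)
    assume "\<not> f k x \<le> - \<delta>"
    then have "f k x + \<delta> > 0" by linarith
    then obtain d1 where d1: "d1 > 0" "\<And>z. dist z x < d1 \<Longrightarrow> dist (f k z) (f k x) < f k x + \<delta>"
      using f_cont[of k] unfolding continuous_on_iff by blast
    have "min d d1 / 2 > 0" using d d1 by simp
    then obtain z0 where z0: "z0 \<in> R" "dist z0 x < min d d1 / 2" "\<not> \<delta> \<le> L z0"
      using x unfolding upper_def mem_Collect_eq by blast
    then have Lz0: "L z0 \<le> - \<delta>"
      using R_outer[of z0] by linarith
    obtain d2 where d2: "d2 > 0" "\<And>z. z \<in> R \<Longrightarrow> dist z z0 < d2 \<Longrightarrow> \<bar>L z - L z0\<bar> \<le> \<delta>"
      using R_local[OF z0(1)] by blast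
    \<comment> \<open>\<open>R\<close> is assumed forward invariant only, so \<open>z0\<close> moved
      back \<open>n\<close> steps may leave \<open>R\<close>; a nearby \<open>w\<close> in
      \<open>R\<close> is taken instead and pushed forward to \<open>z\<close>.\<close>
    have "min (min d d1 / 2) d2 > 0" using d d1 d2 by simp
    moreover have "z0 - real n * \<omega> \<in> closure R"
      using R_dense by simp
    ultimately obtain w where w: "w \<in> R" "dist w (z0 - real n * \<omega>) < min (min d d1 / 2) d2"
      unfolding closure_approachable by blast
    define z where "z = w + real n * \<omega>"
    have z: "z \<in> R" "dist z z0 < min (min d d1 / 2) d2"
      using R_iterate[OF w(1)] w(2) by (simp_all add: z_def dist_real_def algebra_simps)
    have zx: "dist z x < min d d1"
      using z(2) z0(2) dist_triangle[of z x z0] by linarith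
    have "L z \<le> - \<delta>"
      using d2(2)[OF z(1)] z(2) Lz0 R_outer[OF z(1)] \<delta> by linarith
    moreover have "L w \<ge> \<delta>"
      using d(2)[OF w(1)] zx by (simp add: z_def dist_real_def algebra_simps)
    then have "f k z \<le> L z"
      using le_limit[of w k] by (simp add: z_def k(1))
    moreover have "f k z > - \<delta>"
      using d1(2)[of z] zx by (simp add: dist_real_def)
    ultimately show False by linarith
  qed
  with k(2) show ?thesis by blast
qed

end

lemma mono_uminus_uminus:
  fixes h :: "real \<Rightarrow> real"
  shows "mono h \<Longrightarrow> mono (\<lambda>x. - h (- x))"
  by (simp add: mono_def)

text \<open>A sign change of the fibre coordinate preserves the setting, so each fact about
  \<open>upper\<close> has a counterpart for the lower side.\<close>

lemma (in dead_zone) reflect: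
  "dead_zone \<omega> \<delta> (\<lambda>x. - h (- x)) (\<lambda>\<theta>. - r \<theta>) (\<lambda>n \<theta>. - f n \<theta>) (\<lambda>\<theta>. - L \<theta>) R"
proof
  show "\<exists>d>0. \<forall>z\<in>R. dist z \<theta> < d \<longrightarrow> \<bar>- L z - - L \<theta>\<bar> \<le> \<delta>" if "\<theta> \<in> R" for \<theta>
    using R_local[OF that] by (simp add: abs_minus_commute)
qed (use irrational \<delta> h_zero f_0 f_Suc L_step L_per R_dense R_step R_per R_outer in
    \<open>auto simp: on_circle_def intro!: mono_uminus_uminus h_mono continuous_intros f_cont\<close>)

text \<open>The two sides are disjoint and open, so when both are nonempty connectedness leaves a
  point outside both. There \<open>f n\<close> is at most \<open>- \<delta>\<close> and at least
  \<open>\<delta>\<close> infinitely often, which convergence forbids.\<close>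

lemma (in dead_zone) one_sided:
  assumes lim: "\<And>x. (\<lambda>n. f n x) \<longlonglongrightarrow> L x"
  shows "(\<forall>\<theta>\<in>R. L \<theta> \<ge> \<delta>) \<or> (\<forall>\<theta>\<in>R. L \<theta> \<le> - \<delta>)"
proof (rule ccontr)
  interpret neg: dead_zone \<omega> \<delta> "\<lambda>x. - h (- x)" "\<lambda>\<theta>. - r \<theta>" "\<lambda>n \<theta>. - f n \<theta>" "\<lambda>\<theta>. - L \<theta>" R
    by (rule reflect)
  assume "\<not> ?thesis"
  then obtain p q where "p \<in> R" "q \<in> R" "L p < \<delta>" "L q > - \<delta>"
    by force
  then have "neg.upper \<noteq> {}" "upper \<noteq> {}"
    using upperI[of q] neg.upperI[of p] R_outer[of p] R_outer[of q] by fastforce+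
  moreover have "upper \<inter> neg.upper = {}"
  proof (rule ccontr)
    assume "upper \<inter> neg.upper \<noteq> {}"
    then obtain x where x: "x \<in> upper" "x \<in> neg.upper" by blast
    obtain d where d: "d > 0" "\<And>z. z \<in> R \<Longrightarrow> dist z x < d \<Longrightarrow> L z \<ge> \<delta>"
      using x(1) by (auto simp: upper_def)
    obtain d' where d': "d' > 0" "\<And>z. z \<in> R \<Longrightarrow> dist z x < d' \<Longrightarrow> - L z \<ge> \<delta>"
      using x(2) by (auto simp: neg.upper_def)
    have "x \<in> closure R" "min d d' > 0"
      using R_dense d d' by auto
    then obtain z where "z \<in> R" "dist z x < min d d'"
      unfolding closure_approachable by blast
    then show False
      using d(2)[of z] d'(2)[of z] \<delta> by simp
  qed
  ultimately have "upper \<union> neg.upper \<noteq> UNIV"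
    using connected_UNIV[where 'a = real] open_upper neg.open_upper
    unfolding connected_def by blast
  then obtain x where x: "x \<notin> upper" "x \<notin> neg.upper" by blast
  obtain N where N: "\<And>n. n \<ge> N \<Longrightarrow> \<bar>f n x - L x\<bar> < \<delta>"
    using LIMSEQ_D[OF lim[of x] \<delta>] by auto
  obtain n m where "n \<ge> N" "f n x \<le> - \<delta>" "m \<ge> N" "- f m x \<le> - \<delta>"
    using frequently_below[OF x(1) \<open>upper \<noteq> {}\<close>] neg.frequently_below[OF x(2) \<open>neg.upper \<noteq> {}\<close>] by blast
  with N[of n] N[of m] show False by linarith
qed

section \<open>The four fibre maps and the regularity of finite iterates\<close>

text \<open>The lattice form shows continuity, monotonicity and clipping bounds without cases at the
  breakpoints.\<close>

lemma h1_max_min: "a > 0 \<Longrightarrow> h1 a x = max (- (pi / 2)) (min (pi / 2) (a * x))"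
  unfolding h1_def max_def min_def by (auto simp: field_simps) (use pi_gt_zero in linarith)

lemma h2_max_min: "a > 0 \<Longrightarrow> \<delta> > 0 \<Longrightarrow> h2 a \<delta> x = max (a * (x - \<delta>)) (min (a * (x + \<delta>)) 0)"
  unfolding h2_def max_def min_def
  by (auto simp: mult_le_0_iff zero_le_mult_iff)

lemma h3_max: "a > 0 \<Longrightarrow> h3 a x = max (a * x) (- 1)"
  unfolding h3_def max_def by (auto simp: field_simps)

lemma h4_min: "a < 0 \<Longrightarrow> h4 a x = min (a * x) 1"
  unfolding h4_def min_def by (auto simp: field_simps)

lemma fibre_fun_continuous:
  assumes "i \<in> {1, 2, 3} \<Longrightarrow> a > 0" "i = 4 \<Longrightarrow> a < 0" "i \<in> {1, 2, 3, 4}" "\<delta> > 0"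
  shows "continuous_on UNIV (fibre_fun i a \<delta>)"
proof -
  have "continuous_on UNIV (\<lambda>x. fibre_fun i a \<delta> x)"
    using assms
    by (auto simp: fibre_fun_def h1_max_min h2_max_min h3_max h4_min intro!: continuous_intros)
  then show ?thesis .
qed

lemma fibre_fun_affine:
  obtains A where "finite A" "\<And>x. \<exists>(\<alpha>, \<gamma>)\<in>A. fibre_fun i a \<delta> x = \<alpha> * x + \<gamma>"
proof
  show "finite {(0, - (pi / 2)), (0, pi / 2), (a, 0), (a, a * \<delta>), (a, - a * \<delta>), (0, 0), (0, - 1), (0, 1)}"
    by simp
  show "\<exists>(\<alpha>, \<gamma>)\<in>{(0, - (pi / 2)), (0, pi / 2), (a, 0), (a, a * \<delta>), (a, - a * \<delta>), (0, 0), (0, - 1), (0, 1)}.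
      fibre_fun i a \<delta> x = \<alpha> * x + \<gamma>" for x
    by (simp add: fibre_fun_def h1_def h2_def h3_def h4_def algebra_simps)
qed

lemma graph_transform_eq:
  "graph_transform i a \<delta> \<omega> g b \<phi> \<theta> = fibre_fun i a \<delta> (\<phi> (\<theta> - \<omega>)) + forcing_sign i * b * g (\<theta> - \<omega>)"
  by (simp add: graph_transform_def skew_map_def)

lemma piecewise_holder_graph_transform:
  assumes "i \<in> {1, 2, 3} \<Longrightarrow> a > 0" "i = 4 \<Longrightarrow> a < 0" "i \<in> {1, 2, 3, 4}" "\<delta> > 0"
    and g: "g \<in> holder_class s" and \<phi>: "piecewise_holder s \<phi>"
  shows "piecewise_holder s (graph_transform i a \<delta> \<omega> g b \<phi>)"
proof -
  obtain A where "finite A" "\<And>x. \<exists>(\<alpha>, \<gamma>)\<in>A. fibre_fun i a \<delta> x = \<alpha> * x + \<gamma>"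
    using fibre_fun_affine[of i a \<delta>] by blast
  moreover have "graph_transform i a \<delta> \<omega> g b \<phi>
      = (\<lambda>\<theta>. fibre_fun i a \<delta> (\<phi> (\<theta> - \<omega>)) + (forcing_sign i * b) * g (\<theta> - \<omega>))"
    by (simp add: graph_transform_eq fun_eq_iff)
  ultimately show ?thesis
    using piecewise_holder_image[OF \<phi> g fibre_fun_continuous[OF assms(1-4)]] by simp
qed

lemma piecewise_holder_initial_curve:
  assumes g: "g \<in> holder_class s"
  shows "piecewise_holder s (initial_curve i \<omega> g b)"
proof -
  \<comment> \<open>The zero term only matches the two-function form of
    \<open>holder_class_affine\<close>.\<close>
  obtain \<alpha> \<gamma> where eq: "initial_curve i \<omega> g b = (\<lambda>\<theta>. \<alpha> * g (\<theta> - \<omega>) + 0 * g (\<theta> - \<omega>) + \<gamma>)"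
  proof
    show "initial_curve i \<omega> g b = (\<lambda>\<theta>. (if i = 2 \<or> i = 3 then b else - b) * g (\<theta> - \<omega>) + 0 * g (\<theta> - \<omega>)
        + (if i = 1 then pi / 2 else if i = 2 then 0 else if i = 3 then - 1 else 1))"
      by (auto simp: initial_curve_def)
  qed
  have "initial_curve i \<omega> g b \<in> holder_class s"
    unfolding eq by (rule holder_class_affine[OF g g])
  then show ?thesis
    unfolding piecewise_holder_def
    by (intro conjI exI[of _ "{initial_curve i \<omega> g b}"])
      (auto intro: holder_class_on_circle holder_class_continuous)
qed

lemma piecewise_holder_iterated_curve:
  assumes "i \<in> {1, 2, 3} \<Longrightarrow> a > 0" "i = 4 \<Longrightarrow> a < 0" "i \<in> {1, 2, 3, 4}" "\<delta> > 0"
    and g: "g \<in> holder_class s"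
  shows "piecewise_holder s (iterated_curve i a \<delta> \<omega> g b n)"
  by (induction n)
    (auto intro!: piecewise_holder_initial_curve piecewise_holder_graph_transform assms)

text \<open>Each curve is determined by its predecessor, so one repetition freezes the sequence and
  the limit is a finite iterate.\<close>

lemma iterated_curve_stationary_limit:
  assumes "iterated_curve i a \<delta> \<omega> g b (Suc N) = iterated_curve i a \<delta> \<omega> g b N"
  shows "(\<lambda>n. iterated_curve i a \<delta> \<omega> g b n \<theta>) \<longlonglongrightarrow> iterated_curve i a \<delta> \<omega> g b N \<theta>"
proof -
  have "iterated_curve i a \<delta> \<omega> g b n = iterated_curve i a \<delta> \<omega> g b N" if "n \<ge> N" for n
    using that
  proof (induction n rule: dec_induct)
    case (step n)
    then show ?case using assms by (simp split: if_splits)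
  qed simp
  then have "eventually (\<lambda>n. iterated_curve i a \<delta> \<omega> g b n \<theta> = iterated_curve i a \<delta> \<omega> g b N \<theta>) sequentially"
    by (intro eventually_sequentiallyI[of N]) (rule fun_cong)
  then show ?thesis
    by (rule tendsto_eventually)
qed

section \<open>Reduction to a single forced affine rotation\<close>

text \<open>\<open>\<nu>\<close> is the invariant curve for the forcing \<open>g\<close> with
  coefficient one. By linearity each curve \<open>\<mu>\<close> is a constant plus \<open>b\<close>
  or \<open>- b\<close> times \<open>\<nu>\<close>, so one function serves all values of
  \<open>b\<close>.\<close>

locale forced_rotation =
  fixes \<omega> a b :: real and g \<nu> :: "real \<Rightarrow> real"
  assumes irrational: "\<omega> \<notin> (\<lambda>q. 2 * pi * q) ` \<rat>"
    and a: "\<bar>a\<bar> > 1"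
    and g_circle: "on_circle g" and g_cont: "continuous_on UNIV g"
    and \<nu>_circle: "on_circle \<nu>" and \<nu>_cont: "continuous_on UNIV \<nu>"
    and \<nu>_step: "\<And>\<theta>. \<nu> (\<theta> + \<omega>) = a * \<nu> \<theta> + g \<theta>"
begin

text \<open>Up to sign and an additive constant, \<open>b \<kappa>\<close> is the gap between \<open>\<phi>\<^sub>0\<close> and each of the curves it may meet.\<close>

definition \<kappa> :: "real \<Rightarrow> real" where
  "\<kappa> \<theta> = g (\<theta> - \<omega>) - \<nu> \<theta>"

lemma \<kappa>_circle: "on_circle \<kappa>"
  using g_circle \<nu>_circle by (simp add: on_circle_def \<kappa>_def diff_add_eq[symmetric])

lemma \<kappa>_cont: "continuous_on UNIV \<kappa>"
  unfolding \<kappa>_def by (intro continuous_intros continuous_on_compose2[OF g_cont] \<nu>_cont) auto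

lemma g_bounded: obtains B where "B > 0" "\<And>x. \<bar>g x\<bar> \<le> B"
  using on_circle_bounded[OF g_circle g_cont] by blast

lemma \<nu>_bounded: obtains B where "B > 0" "\<And>x. \<bar>\<nu> x\<bar> \<le> B"
  using on_circle_bounded[OF \<nu>_circle \<nu>_cont] by blast

lemma \<kappa>_affine_circle: "on_circle (\<lambda>\<theta>. s * (b * \<kappa> \<theta>) + t)"
  using \<kappa>_circle by (simp add: on_circle_def)

lemma \<kappa>_affine_cont: "continuous_on UNIV (\<lambda>\<theta>. s * (b * \<kappa> \<theta>) + t)"
  by (intro continuous_intros \<kappa>_cont)

lemma \<kappa>_margin:
  assumes "\<And>\<theta>. b * \<kappa> \<theta> < A"
  obtains c where "c > 0" "\<And>\<theta>. b * \<kappa> \<theta> \<le> A - c"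
  using on_circle_less_uniform[OF \<kappa>_affine_circle[of 1 0] \<kappa>_affine_cont[of 1 0], of A] assms by auto

lemma \<kappa>_margin_abs:
  assumes "\<And>\<theta>. \<bar>b * \<kappa> \<theta>\<bar> < A"
  obtains c where "c > 0" "\<And>\<theta>. \<bar>b * \<kappa> \<theta>\<bar> \<le> A - c"
proof -
  have "on_circle (\<lambda>\<theta>. \<bar>b * \<kappa> \<theta>\<bar>)" "continuous_on UNIV (\<lambda>\<theta>. \<bar>b * \<kappa> \<theta>\<bar>)"
    using \<kappa>_circle by (auto simp: on_circle_def intro!: continuous_intros \<kappa>_cont)
  then show thesis
    using on_circle_less_uniform[of "\<lambda>\<theta>. \<bar>b * \<kappa> \<theta>\<bar>" A] assms that by auto
qed

end

text \<open>Supplies the escape condition of \<open>eventually_stationary\<close> beyond a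
  collision: half the value at \<open>\<theta>0\<close> defines an open set to which orbits return
  in bounded time.\<close>

lemma positive_region_visited:
  assumes \<omega>: "\<omega> \<notin> (\<lambda>q. 2 * pi * q) ` \<rat>"
    and u: "on_circle u" "continuous_on UNIV u" "u \<theta>0 > 0"
  obtains c K where "c > 0" "\<And>\<theta>. \<exists>k\<le>K. u (\<theta> + real k * \<omega>) \<ge> c"
proof -
  define W where "W = {x. u x > u \<theta>0 / 2}"
  have "open W"
    unfolding W_def by (intro open_Collect_less u(2) continuous_intros)
  moreover have "W \<noteq> {}"
    using u(3) by (auto simp: W_def intro!: exI[of _ \<theta>0])
  moreover have "x + 2 * pi \<in> W \<longleftrightarrow> x \<in> W" for x
    using u(1) by (simp add: W_def on_circle_def)
  ultimately obtain K where K: "\<And>\<theta>. \<exists>j\<le>K. \<theta> + real j * \<omega> \<in> W"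
    using rotation_return[OF \<omega>, of W] by blast
  show thesis
  proof
    show "u \<theta>0 / 2 > 0" using u(3) by simp
    show "\<exists>k\<le>K. u (\<theta> + real k * \<omega>) \<ge> u \<theta>0 / 2" for \<theta>
      using K[of \<theta>] by (force simp: W_def)
  qed
qed

section \<open>Stationarity of the iterates, family by family\<close>

text \<open>All iterates lie in the strip between \<open>\<phi> 0\<close> and
  \<open>\<phi> 0 - pi\<close>, which is \<open>gamma_tilde1\<close>. Either \<open>\<phi> 0\<close>
  stays above \<open>\<mu>\<close>, or \<open>\<mu>\<close> leaves the strip over some arc; both
  give a margin on one side of \<open>\<mu>\<close>.\<close>

lemma (in forced_rotation) stationary_1:
  assumes a1: "a > 1"
    and \<phi>0: "\<And>\<theta>. \<phi> 0 \<theta> = pi / 2 - b * g (\<theta> - \<omega>)"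
    and \<phi>S: "\<And>n \<theta>. \<phi> (Suc n) \<theta> = h1 a (\<phi> n (\<theta> - \<omega>)) - b * g (\<theta> - \<omega>)"
    and regime: "(\<forall>\<theta>. b * \<kappa> \<theta> < pi / 2) \<or> (\<exists>\<theta>. \<bar>b * \<kappa> \<theta>\<bar> > pi / 2)"
  shows "\<exists>N. \<phi> (Suc N) = \<phi> N"
proof -
  define \<mu> where "\<mu> \<theta> = - (b * \<nu> \<theta>)" for \<theta>
  define F where "F \<theta> x = h1 a x - b * g \<theta>" for \<theta> x
  have h: "h1 a x = max (- (pi / 2)) (min (pi / 2) (a * x))" for x
    using a1 by (intro h1_max_min) simp
  have \<mu>S: "\<mu> (\<theta> + \<omega>) = a * \<mu> \<theta> - b * g \<theta>" for \<theta>
    unfolding \<mu>_def \<nu>_step by (simp add: algebra_simps)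
  have gap: "\<phi> 0 \<theta> - \<mu> \<theta> = pi / 2 - b * \<kappa> \<theta>" for \<theta>
    by (simp add: \<phi>0 \<mu>_def \<kappa>_def algebra_simps)
  have hb: "\<bar>h1 a x\<bar> \<le> pi / 2" for x
    unfolding h using pi_gt_zero by linarith
  have range: "\<phi> n \<theta> \<le> \<phi> 0 \<theta> \<and> \<phi> n \<theta> \<ge> \<phi> 0 \<theta> - pi" for n \<theta>
  proof (cases n)
    case (Suc k)
    then show ?thesis
      using hb[of "\<phi> k (\<theta> - \<omega>)"] \<phi>0[of \<theta>] \<phi>S[of k \<theta>] unfolding Suc by linarith
  qed simp
  then have le: "\<phi> n \<theta> \<le> \<phi> 0 \<theta>" and ge: "\<phi> n \<theta> \<ge> \<phi> 0 \<theta> - pi" for n \<theta>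
    by blast+
  have "on_circle (\<lambda>\<theta>. \<phi> 0 \<theta> - \<mu> \<theta>)" "continuous_on UNIV (\<lambda>\<theta>. \<phi> 0 \<theta> - \<mu> \<theta>)"
    using \<kappa>_affine_circle[of "- 1" "pi / 2"] \<kappa>_affine_cont[of "- 1" "pi / 2"] by (simp_all add: gap)
  then obtain B where B: "\<And>\<theta>. \<bar>\<phi> 0 \<theta> - \<mu> \<theta>\<bar> \<le> B"
    by (rule on_circle_bounded) blast
  have "\<exists>c>0. \<exists>K. \<forall>\<theta>. \<exists>k\<le>K.
      (\<forall>m\<in>{k, Suc k}. \<phi> m (\<theta> + real k * \<omega>) - \<mu> (\<theta> + real k * \<omega>) \<ge> c) \<or>
      (\<forall>m\<in>{k, Suc k}. \<phi> m (\<theta> + real k * \<omega>) - \<mu> (\<theta> + real k * \<omega>) \<le> - c)"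
  proof -
    have "(\<forall>\<theta>. b * \<kappa> \<theta> < pi / 2) \<or> (\<exists>\<theta>. b * \<kappa> \<theta> > pi / 2) \<or> (\<exists>\<theta>. - (b * \<kappa> \<theta>) > pi / 2)"
      using regime by (auto simp: abs_if split: if_splits)
    then consider "\<And>\<theta>. b * \<kappa> \<theta> < pi / 2" | \<theta>0 where "b * \<kappa> \<theta>0 > pi / 2" | \<theta>0 where "- (b * \<kappa> \<theta>0) > pi / 2"
      by blast
    then show ?thesis
    proof cases
      case 1
      then obtain c where c: "c > 0" "\<And>\<theta>. b * \<kappa> \<theta> \<le> pi / 2 - c"
        using \<kappa>_margin by blast
      have 0: "\<phi> 0 \<theta> - \<mu> \<theta> \<ge> c" for \<theta>
        using c(2)[of \<theta>] by (simp add: gap)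
      have "\<phi> (Suc 0) \<theta> - \<mu> \<theta> \<ge> c" for \<theta>
      proof -
        have "a * (\<phi> 0 (\<theta> - \<omega>) - \<mu> (\<theta> - \<omega>)) \<ge> 1 * c"
          using 0[of "\<theta> - \<omega>"] a1 c(1) by (intro mult_mono) auto
        \<comment> \<open>Upper clipping returns \<open>\<phi> 0\<close>, expansion enlarges the
          gap, and lower clipping only raises the value.\<close>
        then have "\<phi> (Suc 0) \<theta> - \<mu> \<theta> \<ge> min (\<phi> 0 \<theta> - \<mu> \<theta>) c"
          using \<mu>S[of "\<theta> - \<omega>"] by (simp add: \<phi>S h \<phi>0[of \<theta>] right_diff_distrib)
        with 0[of \<theta>] show ?thesis by simp
      qed
      with 0 c(1) show ?thesis
        by (intro exI[of _ c] conjI exI[of _ 0]) auto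
    next
      \<comment> \<open>Here \<open>\<mu>\<close> lies above the strip over an arc; in the remaining
        case it lies below.\<close>
      case 2
      then obtain c K where "c > 0" "\<And>\<theta>. \<exists>k\<le>K. 1 * (b * \<kappa> (\<theta> + real k * \<omega>)) + (- (pi / 2)) \<ge> c"
        using positive_region_visited[OF irrational \<kappa>_affine_circle \<kappa>_affine_cont, of 1 \<theta>0 "- (pi / 2)"] by auto
      moreover have "\<phi> m \<theta> - \<mu> \<theta> \<le> - c" if "1 * (b * \<kappa> \<theta>) + (- (pi / 2)) \<ge> c" for m \<theta> c
        using le[of m \<theta>] gap[of \<theta>] that by simp
      ultimately show ?thesis by meson
    next
      case 3
      then obtain c K where "c > 0" "\<And>\<theta>. \<exists>k\<le>K. - 1 * (b * \<kappa> (\<theta> + real k * \<omega>)) + (- (pi / 2)) \<ge> c"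
        using positive_region_visited[OF irrational \<kappa>_affine_circle \<kappa>_affine_cont, of "- 1" \<theta>0 "- (pi / 2)"] by auto
      moreover have "\<phi> m \<theta> - \<mu> \<theta> \<ge> c" if "- 1 * (b * \<kappa> \<theta>) + (- (pi / 2)) \<ge> c" for m \<theta> c
        using ge[of \<theta> m] gap[of \<theta>] that by simp
      ultimately show ?thesis by meson
    qed
  qed
  then obtain c K where c: "c > 0" and esc: "\<And>\<theta>. \<exists>k\<le>K.
      (\<forall>m\<in>{k, Suc k}. \<phi> m (\<theta> + real k * \<omega>) - \<mu> (\<theta> + real k * \<omega>) \<ge> c) \<or>
      (\<forall>m\<in>{k, Suc k}. \<phi> m (\<theta> + real k * \<omega>) - \<mu> (\<theta> + real k * \<omega>) \<le> - c)"
    by blast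
  show ?thesis
  proof (rule eventually_stationary[where F = F and \<mu> = \<mu> and \<omega> = \<omega> and B = "B + pi", OF _ _ _ a1 c _ esc])
    show "\<phi> (Suc n) (\<theta> + \<omega>) = F \<theta> (\<phi> n \<theta>)" for n \<theta>
      by (simp add: F_def \<phi>S)
    show "mono (F \<theta>)" for \<theta>
      unfolding F_def h mono_def
      using a1 by (intro allI impI diff_right_mono max.mono min.mono mult_left_mono) auto
    \<comment> \<open>Distinct images mean that \<open>x\<close> is not clipped from above and
      \<open>y\<close> is not clipped from below.\<close>
    show "a * (x - \<mu> \<theta>) \<le> F \<theta> x - \<mu> (\<theta> + \<omega>) \<and> F \<theta> y - \<mu> (\<theta> + \<omega>) \<le> a * (y - \<mu> \<theta>)"
      if "x < y" "F \<theta> x \<noteq> F \<theta> y" for \<theta> x y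
    proof -
      have "a * x < a * y" using that(1) a1 by simp
      then show ?thesis
        using that(2) by (auto simp: F_def h \<mu>S right_diff_distrib)
    qed
    show "\<bar>\<phi> n \<theta> - \<mu> \<theta>\<bar> \<le> B + pi" for n \<theta>
      using le[of n \<theta>] ge[of \<theta> n] B[of \<theta>] by linarith
  qed
qed

text \<open>\<open>\<phi> 0\<close> lies under \<open>\<mu>\<close> by a margin that no step can
  reduce. This gives the escape condition with \<open>K = 0\<close> and, together with the floor
  \<open>\<phi> 0\<close>, boundedness of the iterates.\<close>

lemma (in forced_rotation) stationary_3:
  assumes a1: "a > 1"
    and \<phi>0: "\<And>\<theta>. \<phi> 0 \<theta> = - 1 + b * g (\<theta> - \<omega>)"
    and \<phi>S: "\<And>n \<theta>. \<phi> (Suc n) \<theta> = h3 a (\<phi> n (\<theta> - \<omega>)) + b * g (\<theta> - \<omega>)"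
    and regime: "\<And>\<theta>. b * \<kappa> \<theta> < 1"
  shows "\<exists>N. \<phi> (Suc N) = \<phi> N"
proof -
  define \<mu> where "\<mu> \<theta> = b * \<nu> \<theta>" for \<theta>
  define F where "F \<theta> x = h3 a x + b * g \<theta>" for \<theta> x
  have h: "h3 a x = max (a * x) (- 1)" for x
    using a1 by (intro h3_max) simp
  have \<mu>S: "\<mu> (\<theta> + \<omega>) = a * \<mu> \<theta> + b * g \<theta>" for \<theta>
    unfolding \<mu>_def \<nu>_step by (simp add: algebra_simps)
  have gap: "\<phi> 0 \<theta> - \<mu> \<theta> = b * \<kappa> \<theta> - 1" for \<theta>
    by (simp add: \<phi>0 \<mu>_def \<kappa>_def algebra_simps)
  obtain c where c: "c > 0" "\<And>\<theta>. b * \<kappa> \<theta> \<le> 1 - c"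
    using regime \<kappa>_margin by blast
  have ge: "\<phi> n \<theta> \<ge> \<phi> 0 \<theta>" for n \<theta>
    by (cases n) (simp_all add: \<phi>0 \<phi>S h)
  have below: "\<phi> n \<theta> - \<mu> \<theta> \<le> - c" for n \<theta>
  proof (induction n arbitrary: \<theta>)
    case 0
    then show ?case using c(2)[of \<theta>] by (simp add: gap)
  next
    case (Suc n)
    have "a * (\<mu> (\<theta> - \<omega>) - \<phi> n (\<theta> - \<omega>)) \<ge> 1 * c"
      using Suc[of "\<theta> - \<omega>"] a1 c(1) by (intro mult_mono) auto
    then have "\<phi> (Suc n) \<theta> - \<mu> \<theta> \<le> max (- c) (\<phi> 0 \<theta> - \<mu> \<theta>)"
      using \<mu>S[of "\<theta> - \<omega>"] by (simp add: \<phi>S h \<phi>0[of \<theta>] right_diff_distrib)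
    then show ?case
      using c(2)[of \<theta>] by (simp add: gap)
  qed
  have "on_circle (\<lambda>\<theta>. \<phi> 0 \<theta> - \<mu> \<theta>)" "continuous_on UNIV (\<lambda>\<theta>. \<phi> 0 \<theta> - \<mu> \<theta>)"
    using \<kappa>_affine_circle[of 1 "- 1"] \<kappa>_affine_cont[of 1 "- 1"] by (simp_all add: gap)
  then obtain B where B: "\<And>\<theta>. \<bar>\<phi> 0 \<theta> - \<mu> \<theta>\<bar> \<le> B"
    by (rule on_circle_bounded) blast
  show ?thesis
  proof (rule eventually_stationary[where F = F and \<mu> = \<mu> and \<omega> = \<omega> and B = B and K = 0, OF _ _ _ a1 c(1)])
    show "\<phi> (Suc n) (\<theta> + \<omega>) = F \<theta> (\<phi> n \<theta>)" for n \<theta>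
      by (simp add: F_def \<phi>S)
    show "mono (F \<theta>)" for \<theta>
      unfolding F_def h mono_def
      using a1 by (intro allI impI add_right_mono max.mono mult_left_mono) auto
    show "a * (x - \<mu> \<theta>) \<le> F \<theta> x - \<mu> (\<theta> + \<omega>) \<and> F \<theta> y - \<mu> (\<theta> + \<omega>) \<le> a * (y - \<mu> \<theta>)"
      if "x < y" "F \<theta> x \<noteq> F \<theta> y" for \<theta> x y
    proof -
      have "a * x < a * y" using that(1) a1 by simp
      then show ?thesis
        using that(2) by (auto simp: F_def h \<mu>S right_diff_distrib)
    qed
    show "\<bar>\<phi> n \<theta> - \<mu> \<theta>\<bar> \<le> B" for n \<theta>
      using ge[of \<theta> n] below[of n \<theta>] B[of \<theta>] c(1) by linarith
  qed (use below in auto)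
qed

text \<open>Two decreasing steps form one increasing step with expansion rate
  \<open>a\<^sup>2\<close> over the rotation by \<open>2 * \<omega>\<close>. The cap at
  \<open>1\<close>, passed once more through \<open>h4\<close>, bounds the iterates from below as
  well, so they stay bounded even beyond the collision.\<close>

lemma (in forced_rotation) stationary_4:
  assumes a1: "a < - 1"
    and \<phi>0: "\<And>\<theta>. \<phi> 0 \<theta> = 1 - b * g (\<theta> - \<omega>)"
    and \<phi>S: "\<And>n \<theta>. \<phi> (Suc n) \<theta> =
        h4 a (h4 a (\<phi> n (\<theta> - \<omega> - \<omega>)) - b * g (\<theta> - \<omega> - \<omega>)) - b * g (\<theta> - \<omega>)"
    and regime: "(\<forall>\<theta>. b * \<kappa> \<theta> < 1) \<or> (\<exists>\<theta>. b * \<kappa> \<theta> > 1)"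
  shows "\<exists>N. \<phi> (Suc N) = \<phi> N"
proof -
  define \<mu> where "\<mu> \<theta> = - (b * \<nu> \<theta>)" for \<theta>
  define F where "F \<theta> x = h4 a (h4 a x - b * g \<theta>) - b * g (\<theta> + \<omega>)" for \<theta> x
  have h: "h4 a x = min (a * x) 1" for x
    using a1 by (intro h4_min) simp
  have amono: "a * y \<le> a * x" if "x \<le> y" for x y
    using a1 that by (intro mult_left_mono_neg) auto
  have hmono: "h4 a y \<le> h4 a x" if "x \<le> y" for x y
    using amono[OF that] by (auto simp: h min_def)
  have a2: "a\<^sup>2 > 1"
    using one_less_power[of "- a" 2] a1 by simp
  have \<mu>S: "\<mu> (\<theta> + \<omega>) = a * \<mu> \<theta> - b * g \<theta>" for \<theta>
    unfolding \<mu>_def \<nu>_step by (simp add: algebra_simps)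
  have \<mu>SS: "\<mu> (\<theta> + 2 * \<omega>) = a * (a * \<mu> \<theta> - b * g \<theta>) - b * g (\<theta> + \<omega>)" for \<theta>
  proof -
    have "\<theta> + 2 * \<omega> = \<theta> + \<omega> + \<omega>" by simp
    then show ?thesis by (simp only: \<mu>S)
  qed
  have gap: "\<phi> 0 \<theta> - \<mu> \<theta> = 1 - b * \<kappa> \<theta>" for \<theta>
    by (simp add: \<phi>0 \<mu>_def \<kappa>_def algebra_simps)
  have le: "\<phi> n \<theta> \<le> \<phi> 0 \<theta>" for n \<theta>
    by (cases n) (simp_all add: \<phi>0 \<phi>S h)
  obtain G where G: "G > 0" "\<And>\<theta>. \<bar>g \<theta>\<bar> \<le> G"
    using g_bounded by blast
  have bG: "\<bar>b * g \<theta>\<bar> \<le> \<bar>b\<bar> * G" for \<theta>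
    using G(2)[of \<theta>] by (simp add: abs_mult mult_left_mono)
  \<comment> \<open>The inner \<open>h4\<close> is at most \<open>1\<close>, so with the forcing it
    is at most \<open>1 + \<bar>b\<bar> * G\<close>; the outer \<open>h4\<close>, being decreasing,
    turns this into a lower bound.\<close>
  define D where "D = \<bar>a * (1 + \<bar>b\<bar> * G)\<bar> + 1 + \<bar>b\<bar> * G"
  have ge: "\<phi> n \<theta> \<ge> - D" for n \<theta>
  proof (cases n)
    case 0
    then show ?thesis
      using bG[of "\<theta> - \<omega>"] by (simp add: \<phi>0 D_def)
  next
    case (Suc k)
    have "h4 a (1 + \<bar>b\<bar> * G) \<le> h4 a (h4 a (\<phi> k (\<theta> - \<omega> - \<omega>)) - b * g (\<theta> - \<omega> - \<omega>))"
      using bG[of "\<theta> - \<omega> - \<omega>"] by (intro hmono) (simp add: h)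
    moreover have "h4 a (1 + \<bar>b\<bar> * G) \<ge> - \<bar>a * (1 + \<bar>b\<bar> * G)\<bar>"
      by (auto simp: h min_def)
    ultimately show ?thesis
      using bG[of "\<theta> - \<omega>"] by (simp add: Suc \<phi>S D_def)
  qed
  obtain V where V: "V > 0" "\<And>\<theta>. \<bar>\<nu> \<theta>\<bar> \<le> V"
    using \<nu>_bounded by blast
  have bV: "\<bar>\<mu> \<theta>\<bar> \<le> \<bar>b\<bar> * V" for \<theta>
    using V(2)[of \<theta>] by (simp add: \<mu>_def abs_mult mult_left_mono)
  have "\<exists>c>0. \<exists>K. \<forall>\<theta>. \<exists>k\<le>K.
      (\<forall>m\<in>{k, Suc k}. \<phi> m (\<theta> + real k * (2 * \<omega>)) - \<mu> (\<theta> + real k * (2 * \<omega>)) \<ge> c) \<or>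
      (\<forall>m\<in>{k, Suc k}. \<phi> m (\<theta> + real k * (2 * \<omega>)) - \<mu> (\<theta> + real k * (2 * \<omega>)) \<le> - c)"
  proof -
    consider "\<And>\<theta>. b * \<kappa> \<theta> < 1" | \<theta>0 where "b * \<kappa> \<theta>0 > 1"
      using regime by blast
    then show ?thesis
    proof cases
      case 1
      then obtain c where c: "c > 0" "\<And>\<theta>. b * \<kappa> \<theta> \<le> 1 - c"
        using \<kappa>_margin by blast
      have 0: "\<phi> 0 \<theta> - \<mu> \<theta> \<ge> c" for \<theta>
        using c(2)[of \<theta>] by (simp add: gap)
      have "\<phi> (Suc 0) \<theta> - \<mu> \<theta> \<ge> c" for \<theta>
      proof -
        \<comment> \<open>Gaps to \<open>\<mu>\<close> before and after one application: the first
          is at least \<open>c\<close>, the negative slope makes the second at most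
          \<open>- c\<close>, and the next application restores a gap of at least
          \<open>c\<close>.\<close>
        define x where "x = \<phi> 0 (\<theta> - \<omega> - \<omega>) - \<mu> (\<theta> - \<omega> - \<omega>)"
        define y where "y = h4 a (\<phi> 0 (\<theta> - \<omega> - \<omega>)) - b * g (\<theta> - \<omega> - \<omega>) - \<mu> (\<theta> - \<omega>)"
        have "y \<le> a * x"
          using \<mu>S[of "\<theta> - \<omega> - \<omega>"] by (simp add: y_def x_def h right_diff_distrib)
        also have "a * x \<le> a * c"
          using 0[of "\<theta> - \<omega> - \<omega>"] by (intro amono) (simp add: x_def)
        also have "a * c \<le> - c"
          using mult_right_mono[of a "- 1" c] a1 c(1) by simp
        finally have "a * y \<ge> a * (- c)"
          by (rule amono)
        moreover have "a * (- c) \<ge> c"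
          using mult_right_mono[of a "- 1" c] a1 c(1) by simp
        moreover have "\<phi> (Suc 0) \<theta> - \<mu> \<theta> = min (a * y) (\<phi> 0 \<theta> - \<mu> \<theta>)"
          using \<mu>S[of "\<theta> - \<omega>"] by (simp add: \<phi>S y_def h[of "_ - _"] \<phi>0[of \<theta>] right_diff_distrib min_diff_distrib_left)
        ultimately show ?thesis
          using 0[of \<theta>] by simp
      qed
      with 0 c(1) show ?thesis
        by (intro exI[of _ c] conjI exI[of _ 0]) auto
    next
      case 2
      then obtain c K where "c > 0" "\<And>\<theta>. \<exists>k\<le>K. 1 * (b * \<kappa> (\<theta> + real k * (2 * \<omega>))) + (- 1) \<ge> c"
        using positive_region_visited[OF irrational_rotation_double[OF irrational] \<kappa>_affine_circle \<kappa>_affine_cont, of 1 \<theta>0 "- 1"]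
        by auto
      moreover have "\<phi> m \<theta> - \<mu> \<theta> \<le> - c" if "1 * (b * \<kappa> \<theta>) + (- 1) \<ge> c" for m \<theta> c
        using le[of m \<theta>] gap[of \<theta>] that by simp
      ultimately show ?thesis by meson
    qed
  qed
  then obtain c K where c: "c > 0" and esc: "\<And>\<theta>. \<exists>k\<le>K.
      (\<forall>m\<in>{k, Suc k}. \<phi> m (\<theta> + real k * (2 * \<omega>)) - \<mu> (\<theta> + real k * (2 * \<omega>)) \<ge> c) \<or>
      (\<forall>m\<in>{k, Suc k}. \<phi> m (\<theta> + real k * (2 * \<omega>)) - \<mu> (\<theta> + real k * (2 * \<omega>)) \<le> - c)"
    by blast
  show ?thesis
  proof (rule eventually_stationary[where F = F and \<mu> = \<mu> and \<omega> = "2 * \<omega>" and B = "D + 1 + \<bar>b\<bar> * G + \<bar>b\<bar> * V",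
        OF _ _ _ a2 c _ esc])
    show "\<phi> (Suc n) (\<theta> + 2 * \<omega>) = F \<theta> (\<phi> n \<theta>)" for n \<theta>
    proof -
      have "\<theta> + 2 * \<omega> - \<omega> = \<theta> + \<omega>" by simp
      then show ?thesis by (simp only: F_def \<phi>S add_diff_cancel_right')
    qed
    show "mono (F \<theta>)" for \<theta>
      by (auto simp: F_def mono_def intro!: hmono)
    show "a\<^sup>2 * (x - \<mu> \<theta>) \<le> F \<theta> x - \<mu> (\<theta> + 2 * \<omega>) \<and> F \<theta> y - \<mu> (\<theta> + 2 * \<omega>) \<le> a\<^sup>2 * (y - \<mu> \<theta>)"
      if "x < y" "F \<theta> x \<noteq> F \<theta> y" for \<theta> x y
    proof -
      \<comment> \<open>Each application reverses the order, so clipping is excluded for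
        \<open>y\<close> in the inner one and for \<open>x1\<close> in the outer one; at the other
        point the affine value is still an upper bound.\<close>
      define x1 where "x1 = h4 a x - b * g \<theta>"
      define y1 where "y1 = h4 a y - b * g \<theta>"
      have "a * y < a * x" using that(1) a1 by simp
      have ne: "x1 \<noteq> y1" "h4 a x1 \<noteq> h4 a y1"
        using that(2) by (auto simp: F_def x1_def y1_def)
      have y1: "y1 = a * y - b * g \<theta>" and x1: "x1 \<le> a * x - b * g \<theta>"
        using ne(1) \<open>a * y < a * x\<close> by (auto simp: x1_def y1_def h min_def split: if_splits)
      have "y1 < x1"
        using ne(1) \<open>a * y < a * x\<close> by (auto simp: x1_def y1_def h min_def split: if_splits)
      then have "a * x1 < a * y1" using a1 by simp
      then have x2: "h4 a x1 = a * x1" and y2: "h4 a y1 \<le> a * y1"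
        using ne(2) by (auto simp: h min_def split: if_splits)
      have "a * x1 \<ge> a * (a * x - b * g \<theta>)"
        by (rule amono[OF x1])
      then show ?thesis
        using x2 y2 unfolding F_def x1_def[symmetric] y1_def[symmetric] \<mu>SS y1
        by (simp add: power2_eq_square algebra_simps)
    qed
    show "\<bar>\<phi> n \<theta> - \<mu> \<theta>\<bar> \<le> D + 1 + \<bar>b\<bar> * G + \<bar>b\<bar> * V" for n \<theta>
    proof -
      have "D \<ge> 1 + \<bar>b\<bar> * G" by (simp add: D_def)
      then show ?thesis
        using le[of n \<theta>] ge[of n \<theta>] bV[of \<theta>] bG[of "\<theta> - \<omega>"] \<phi>0[of \<theta>] by linarith
    qed
  qed
qed

lemma positive_sequence_not_bounded:
  fixes v :: "nat \<Rightarrow> real"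
  assumes "a > 1" "v 0 > 0" "\<And>k. v (Suc k) = a * v k" "\<And>k. v k \<le> B"
  shows False
proof -
  have v: "v k = a ^ k * v 0" for k
    by (induction k) (simp_all add: assms(3))
  obtain k where "B / v 0 < a ^ k"
    using real_arch_pow[OF assms(1)] by blast
  then have "B < v k"
    using assms(2) by (subst v) (simp add: pos_divide_less_eq)
  with assms(4)[of k] show False by simp
qed

text \<open>A coincidence of consecutive curves over \<open>W\<close> is carried along by the
  rotation, and every point is reached from \<open>W\<close> within a bounded number of
  steps.\<close>

lemma stationary_of_dead_region:
  fixes \<phi> :: "nat \<Rightarrow> real \<Rightarrow> real"
  assumes \<omega>: "\<omega> \<notin> (\<lambda>q. 2 * pi * q) ` \<rat>"
    and W: "open W" "W \<noteq> {}" "\<And>x. x + 2 * pi \<in> W \<longleftrightarrow> x \<in> W"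
    and step: "\<And>n \<theta>. \<phi> (Suc n) (\<theta> + \<omega>) = F \<theta> (\<phi> n \<theta>)"
    and dead: "\<And>n \<theta>. \<theta> \<in> W \<Longrightarrow> n \<ge> N \<Longrightarrow> F \<theta> (\<phi> (Suc n) \<theta>) = F \<theta> (\<phi> n \<theta>)"
  shows "\<exists>N. \<phi> (Suc N) = \<phi> N"
proof -
  obtain K where K: "\<And>\<theta>. \<exists>j\<le>K. \<theta> + real j * (- \<omega>) \<in> W"
    using rotation_return[OF irrational_rotation_uminus[OF \<omega>] W] by blast
  have "\<phi> (Suc (Suc (N + K))) \<theta> = \<phi> (Suc (N + K)) \<theta>" for \<theta>
  proof -
    obtain j where j: "j \<le> K" "\<theta> - \<omega> - real j * \<omega> \<in> W"
      using K[of "\<theta> - \<omega>"] by auto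
    define z where "z = \<theta> - \<omega> - real j * \<omega>"
    \<comment> \<open>Chosen so that the coincidence, carried along \<open>j\<close> further steps,
      always arrives at the index \<open>Suc (N + K)\<close>, whatever \<open>j\<close> is.\<close>
    define n where "n = N + K - j"
    have "\<phi> (Suc (Suc (n + m))) (z + real (Suc m) * \<omega>) = \<phi> (Suc (n + m)) (z + real (Suc m) * \<omega>)" for m
    proof (induction m)
      case 0
      have "\<phi> (Suc (Suc n)) (z + \<omega>) = \<phi> (Suc n) (z + \<omega>)"
        unfolding step using j by (intro dead) (simp_all add: z_def n_def)
      then show ?case by simp
    next
      case (Suc m)
      have "\<phi> (Suc (Suc (n + Suc m))) (z + real (Suc m) * \<omega> + \<omega>) = \<phi> (Suc (n + Suc m)) (z + real (Suc m) * \<omega> + \<omega>)"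
        unfolding step using Suc by simp
      then show ?case by (simp add: algebra_simps)
    qed
    from this[of j] show ?thesis
      using j(1) by (simp add: z_def n_def algebra_simps)
  qed
  then show ?thesis by blast
qed

text \<open>The iterates are trapped between two repelling curves. If the limit enters the collapsed
  zone at a point of \<open>R\<close>, a dead region results; otherwise it follows one expanding
  branch forever, which boundedness forbids.\<close>

lemma (in forced_rotation) stationary_2:
  assumes a1: "a > 1" and \<delta>: "\<delta> > 0"
    and \<phi>0: "\<And>\<theta>. \<phi> 0 \<theta> = b * g (\<theta> - \<omega>)"
    and \<phi>S: "\<And>n \<theta>. \<phi> (Suc n) \<theta> = h2 a \<delta> (\<phi> n (\<theta> - \<omega>)) + b * g (\<theta> - \<omega>)"
    and \<phi>_circle: "\<And>n. on_circle (\<phi> n)" and \<phi>_cont: "\<And>n. continuous_on UNIV (\<phi> n)"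
    and conv: "\<And>\<theta>. convergent (\<lambda>n. \<phi> n \<theta>)"
    and regime: "\<And>\<theta>. \<bar>b * \<kappa> \<theta>\<bar> < a * \<delta> / (a - 1)"
  shows "\<exists>N. \<phi> (Suc N) = \<phi> N"
proof -
  have h: "h2 a \<delta> x = max (a * (x - \<delta>)) (min (a * (x + \<delta>)) 0)" for x
    using a1 \<delta> by (intro h2_max_min) auto
  \<comment> \<open>The fixed point of the unforced branch \<open>a * (x - \<delta>)\<close>; by
    symmetry \<open>- S\<close> is that of the other branch.\<close>
  define S where "S = a * \<delta> / (a - 1)"
  have S: "a * (S - \<delta>) = S"
    using a1 by (simp add: S_def field_simps)
  define \<mu> where "\<mu> \<theta> = S + b * \<nu> \<theta>" for \<theta>
  define \<mu>' where "\<mu>' \<theta> = - S + b * \<nu> \<theta>" for \<theta>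
  have \<mu>S: "\<mu> (\<theta> + \<omega>) = a * (\<mu> \<theta> - \<delta>) + b * g \<theta>" for \<theta>
    using S unfolding \<mu>_def \<nu>_step by (simp add: algebra_simps)
  have \<mu>S': "\<mu>' (\<theta> + \<omega>) = a * (\<mu>' \<theta> + \<delta>) + b * g \<theta>" for \<theta>
    using S unfolding \<mu>'_def \<nu>_step by (simp add: algebra_simps)
  obtain V where V: "V > 0" "\<And>\<theta>. \<bar>\<nu> \<theta>\<bar> \<le> V"
    using \<nu>_bounded by blast
  have bV: "\<bar>b * \<nu> \<theta>\<bar> \<le> \<bar>b\<bar> * V" for \<theta>
    using V(2)[of \<theta>] by (simp add: abs_mult mult_left_mono)
  obtain c where c: "c > 0" "\<And>\<theta>. \<bar>b * \<kappa> \<theta>\<bar> \<le> S - c"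
    using \<kappa>_margin_abs regime unfolding S_def by blast
  have gap: "\<phi> 0 \<theta> = b * \<nu> \<theta> + b * \<kappa> \<theta>" for \<theta>
    by (simp add: \<phi>0 \<kappa>_def algebra_simps)
  \<comment> \<open>An outer branch enlarges the gap to its own repelling curve, and the middle
    branch restarts from \<open>\<phi> 0\<close>, so the margin \<open>c\<close> survives.\<close>
  have bounds: "\<mu>' \<theta> + c \<le> \<phi> n \<theta> \<and> \<phi> n \<theta> \<le> \<mu> \<theta> - c" for n \<theta>
  proof (induction n arbitrary: \<theta>)
    case 0
    then show ?case
      using c(2)[of \<theta>] by (simp add: gap \<mu>_def \<mu>'_def abs_le_iff)
  next
    case (Suc n)
    define x where "x = \<phi> n (\<theta> - \<omega>)"
    have x: "\<mu>' (\<theta> - \<omega>) + c \<le> x" "x \<le> \<mu> (\<theta> - \<omega>) - c"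
      using Suc[of "\<theta> - \<omega>"] by (simp_all add: x_def)
    have ac: "a * c \<ge> 1 * c"
      using a1 c(1) by (intro mult_right_mono) auto
    have "a * (x - \<delta>) \<le> a * (\<mu> (\<theta> - \<omega>) - c - \<delta>)" "a * (\<mu>' (\<theta> - \<omega>) + c + \<delta>) \<le> a * (x + \<delta>)"
      using x a1 by (simp_all add: mult_left_mono)
    then have "a * (x - \<delta>) + b * g (\<theta> - \<omega>) \<le> \<mu> \<theta> - c" "\<mu>' \<theta> + c \<le> a * (x + \<delta>) + b * g (\<theta> - \<omega>)"
      using \<mu>S[of "\<theta> - \<omega>"] \<mu>S'[of "\<theta> - \<omega>"] ac by (simp_all add: algebra_simps)
    moreover have "b * g (\<theta> - \<omega>) \<le> \<mu> \<theta> - c" "\<mu>' \<theta> + c \<le> b * g (\<theta> - \<omega>)"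
      using c(2)[of \<theta>] gap[of \<theta>] \<phi>0[of \<theta>] by (simp_all add: \<mu>_def \<mu>'_def abs_le_iff)
    moreover have "\<phi> (Suc n) \<theta>
        = max (a * (x - \<delta>) + b * g (\<theta> - \<omega>)) (min (a * (x + \<delta>) + b * g (\<theta> - \<omega>)) (b * g (\<theta> - \<omega>)))"
      unfolding \<phi>S x_def[symmetric] h by (simp add: max_def min_def)
    moreover have "a * (x - \<delta>) \<le> a * (x + \<delta>)"
      using a1 \<delta> by simp
    ultimately show ?case
      by (auto simp: max_def min_def)
  qed
  obtain L where L: "\<And>\<theta>. (\<lambda>n. \<phi> n \<theta>) \<longlonglongrightarrow> L \<theta>"
    using conv unfolding convergent_def by metis
  have L_bounds: "\<mu>' \<theta> + c \<le> L \<theta>" "L \<theta> \<le> \<mu> \<theta> - c" for \<theta>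
    using LIMSEQ_le_const[OF L[of \<theta>]] LIMSEQ_le_const2[OF L[of \<theta>]] bounds by blast+
  have step: "\<phi> (Suc n) (\<theta> + \<omega>) = h2 a \<delta> (\<phi> n \<theta>) + b * g \<theta>" for n \<theta>
    by (simp add: \<phi>S)
  have h_cont: "continuous_on UNIV (h2 a \<delta>)"
    unfolding h[abs_def] by (intro continuous_intros)
  have L_step: "L (\<theta> + \<omega>) = h2 a \<delta> (L \<theta>) + b * g \<theta>" for \<theta>
  proof (rule LIMSEQ_unique)
    show "(\<lambda>n. \<phi> (Suc n) (\<theta> + \<omega>)) \<longlonglongrightarrow> L (\<theta> + \<omega>)"
      by (rule LIMSEQ_Suc[OF L])
    show "(\<lambda>n. \<phi> (Suc n) (\<theta> + \<omega>)) \<longlonglongrightarrow> h2 a \<delta> (L \<theta>) + b * g \<theta>"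
      unfolding step
      by (intro tendsto_intros continuous_on_tendsto_compose[OF h_cont L]) auto
  qed
  have L_circle: "on_circle L"
    unfolding on_circle_def
  proof
    fix \<theta>
    have "(\<lambda>n. \<phi> n (\<theta> + 2 * pi)) = (\<lambda>n. \<phi> n \<theta>)"
      using \<phi>_circle by (simp add: on_circle_def)
    then show "L (\<theta> + 2 * pi) = L \<theta>"
      using L[of "\<theta> + 2 * pi"] L[of \<theta>] LIMSEQ_unique by metis
  qed
  define R where "R = {x. jointly_convergent_at \<phi> L x}"
  have R_dense: "closure R = UNIV"
    unfolding R_def by (rule jointly_convergent_dense[OF \<phi>_cont L])
  have R_D: "\<exists>d>0. \<exists>N. \<forall>z n. dist z \<theta> < d \<longrightarrow> n \<ge> N \<longrightarrow> dist (\<phi> n z) (L \<theta>) < e"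
    if "\<theta> \<in> R" "e > 0" for \<theta> e
    using that by (simp add: R_def jointly_convergent_at_def)
  show ?thesis
  proof (cases "\<exists>\<theta>\<in>R. \<bar>L \<theta>\<bar> < \<delta>")
    case True
    then obtain \<theta>1 where \<theta>1: "\<theta>1 \<in> R" "\<delta> - \<bar>L \<theta>1\<bar> > 0" by auto
    obtain d N where d: "d > 0"
      and N: "\<And>z n. dist z \<theta>1 < d \<Longrightarrow> n \<ge> N \<Longrightarrow> dist (\<phi> n z) (L \<theta>1) < \<delta> - \<bar>L \<theta>1\<bar>"
      using R_D[OF \<theta>1] by blast
    \<comment> \<open>The neighbourhood of \<open>\<theta>1\<close> is repeated with period
      \<open>2 * pi\<close> to represent an arc of the circle.\<close>
    define W where "W = {z. \<exists>m::int. dist (z + 2 * pi * of_int m) \<theta>1 < d}"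
    have "open W"
      unfolding W_def by (intro open_Collect_ex open_Collect_less continuous_intros)
    moreover have "W \<noteq> {}"
      using d by (auto simp: W_def intro!: exI[of _ \<theta>1] exI[of _ "0::int"])
    moreover have "x + 2 * pi \<in> W \<longleftrightarrow> x \<in> W" for x
    proof
      assume "x + 2 * pi \<in> W"
      then obtain m where "dist (x + 2 * pi + 2 * pi * of_int m) \<theta>1 < d"
        by (auto simp: W_def)
      then show "x \<in> W"
        unfolding W_def by (intro CollectI exI[of _ "m + 1"]) (simp add: algebra_simps)
    next
      assume "x \<in> W"
      then obtain m where "dist (x + 2 * pi * of_int m) \<theta>1 < d"
        by (auto simp: W_def)
      then show "x + 2 * pi \<in> W"
        unfolding W_def by (intro CollectI exI[of _ "m - 1"]) (simp add: algebra_simps)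
    qed
    moreover have "h2 a \<delta> (\<phi> n z) = 0" if z: "z \<in> W" and n: "n \<ge> N" for n z
    proof -
      obtain m where "dist (z + 2 * pi * of_int m) \<theta>1 < d"
        using z by (auto simp: W_def)
      from N[OF this n] have "dist (\<phi> n z) (L \<theta>1) < \<delta> - \<bar>L \<theta>1\<bar>"
        by (simp add: on_circle_int[OF \<phi>_circle])
      then have "\<bar>\<phi> n z\<bar> \<le> \<delta>"
        by (simp add: dist_real_def)
      then show ?thesis
        by (auto simp: h2_def abs_le_iff)
    qed
    ultimately show ?thesis
      by (intro stationary_of_dead_region[where W = W and N = N and F = "\<lambda>\<theta> x. h2 a \<delta> x + b * g \<theta>", OF irrational])
        (auto simp: step)
  next
    case False
    have R_step: "\<theta> + \<omega> \<in> R" if \<theta>: "\<theta> \<in> R" for \<theta>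
      unfolding R_def jointly_convergent_at_def mem_Collect_eq
    proof (intro allI impI)
      fix e :: real assume e: "e > 0"
      have "isCont (h2 a \<delta>) (L \<theta>)" "isCont g \<theta>"
        using h_cont g_cont by (simp_all add: continuous_on_eq_continuous_at)
      moreover have "e / 2 / (\<bar>b\<bar> + 1) > 0" "e / 2 > 0" using e by simp_all
      ultimately obtain d1 d2 where d1: "d1 > 0" "\<And>x. dist x (L \<theta>) < d1 \<Longrightarrow> dist (h2 a \<delta> x) (h2 a \<delta> (L \<theta>)) < e / 2"
        and d2: "d2 > 0" "\<And>x. dist x \<theta> < d2 \<Longrightarrow> dist (g x) (g \<theta>) < e / 2 / (\<bar>b\<bar> + 1)"
        unfolding continuous_at_eps_delta by (metis dist_commute)
      obtain d N where d: "d > 0" and N: "\<And>z n. dist z \<theta> < d \<Longrightarrow> n \<ge> N \<Longrightarrow> dist (\<phi> n z) (L \<theta>) < d1"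
        using R_D[OF \<theta> d1(1)] by blast
      have "dist (\<phi> n z) (L (\<theta> + \<omega>)) < e" if z: "dist z (\<theta> + \<omega>) < min d d2" and n: "n \<ge> Suc N" for z n
      proof -
        obtain k where k: "n = Suc k" "k \<ge> N"
          using n by (cases n) auto
        have z': "dist (z - \<omega>) \<theta> < min d d2"
          using z by (simp add: dist_real_def algebra_simps)
        have 1: "dist (h2 a \<delta> (\<phi> k (z - \<omega>))) (h2 a \<delta> (L \<theta>)) < e / 2"
          using z' by (intro d1(2) N k(2)) simp
        have "dist (g (z - \<omega>)) (g \<theta>) < e / 2 / (\<bar>b\<bar> + 1)"
          using z' by (intro d2(2)) simp
        then have "(\<bar>b\<bar> + 1) * \<bar>g (z - \<omega>) - g \<theta>\<bar> < e / 2"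
          by (simp add: dist_real_def field_simps)
        moreover have "\<bar>b * g (z - \<omega>) - b * g \<theta>\<bar> = \<bar>b\<bar> * \<bar>g (z - \<omega>) - g \<theta>\<bar>"
          by (simp add: abs_mult[symmetric] right_diff_distrib)
        moreover have "\<bar>b\<bar> * \<bar>g (z - \<omega>) - g \<theta>\<bar> \<le> (\<bar>b\<bar> + 1) * \<bar>g (z - \<omega>) - g \<theta>\<bar>"
          by (intro mult_right_mono) auto
        ultimately have "\<bar>b * g (z - \<omega>) - b * g \<theta>\<bar> < e / 2"
          by simp
        with 1 show ?thesis
          unfolding k(1) \<phi>S L_step dist_real_def by linarith
      qed
      with d d2(1) show "\<exists>d>0. \<exists>N. \<forall>z n. dist z (\<theta> + \<omega>) < d \<longrightarrow> n \<ge> N \<longrightarrow> dist (\<phi> n z) (L (\<theta> + \<omega>)) < e"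
        by (intro exI[of _ "min d d2"]) auto
    qed
    interpret dead_zone \<omega> \<delta> "h2 a \<delta>" "\<lambda>\<theta>. b * g \<theta>" \<phi> L R
    proof
      show "mono (h2 a \<delta>)"
        unfolding h mono_def
        using a1 by (intro allI impI max.mono min.mono mult_left_mono) auto
      show "h2 a \<delta> x = 0" if "\<bar>x\<bar> \<le> \<delta>" for x
        using that by (auto simp: h2_def abs_le_iff)
      show "\<theta> + 2 * pi \<in> R \<longleftrightarrow> \<theta> \<in> R" for \<theta>
      proof -
        have "(\<forall>z n. dist z (\<theta> + 2 * pi) < d \<longrightarrow> n \<ge> N \<longrightarrow> dist (\<phi> n z) (L (\<theta> + 2 * pi)) < e)
            \<longleftrightarrow> (\<forall>z n. dist z \<theta> < d \<longrightarrow> n \<ge> N \<longrightarrow> dist (\<phi> n z) (L \<theta>) < e)" (is "?l \<longleftrightarrow> ?r") for d N e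
        proof
          assume l: ?l
          show ?r
          proof (intro allI impI)
            fix z n assume "dist z \<theta> < d" "n \<ge> N"
            then have "dist (\<phi> n (z + 2 * pi)) (L (\<theta> + 2 * pi)) < e"
              using l by simp
            then show "dist (\<phi> n z) (L \<theta>) < e"
              using \<phi>_circle L_circle by (simp add: on_circle_def)
          qed
        next
          assume r: ?r
          show ?l
          proof (intro allI impI)
            fix z n assume "dist z (\<theta> + 2 * pi) < d" "n \<ge> N"
            then have "dist (\<phi> n (z - 2 * pi)) (L \<theta>) < e"
              using r by (simp add: dist_real_def algebra_simps)
            then show "dist (\<phi> n z) (L (\<theta> + 2 * pi)) < e"
              using \<phi>_circle[of n, unfolded on_circle_def, rule_format, of "z - 2 * pi"] L_circle
              by (simp add: on_circle_def)
          qed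
        qed
        then show ?thesis
          by (simp add: R_def jointly_convergent_at_def)
      qed
      show "\<exists>d>0. \<forall>z\<in>R. dist z \<theta> < d \<longrightarrow> \<bar>L z - L \<theta>\<bar> \<le> \<delta>" if \<theta>: "\<theta> \<in> R" for \<theta>
      proof -
        obtain d N where d: "d > 0" and N: "\<And>z n. dist z \<theta> < d \<Longrightarrow> n \<ge> N \<Longrightarrow> dist (\<phi> n z) (L \<theta>) < \<delta>"
          using R_D[OF \<theta> \<delta>] by blast
        \<comment> \<open>Letting \<open>n\<close> tend to infinity at fixed \<open>z\<close> turns
          the strict bound into a weak one.\<close>
        have "dist (L z) (L \<theta>) \<le> \<delta>" if "dist z \<theta> < d" for z
          using N[OF that]
          by (intro tendsto_upperbound[OF tendsto_dist[OF L tendsto_const]])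
            (auto intro!: eventually_sequentiallyI[of N] less_imp_le)
        with d show ?thesis
          by (auto simp: dist_real_def)
      qed
    qed (use irrational \<delta> \<phi>0 step \<phi>_cont L_step L_circle R_dense R_step False in \<open>auto simp: not_less\<close>)
    obtain p where p: "p \<in> R"
      using R_dense by fastforce
    have pk: "p + real k * \<omega> \<in> R" for k
      by (rule R_iterate[OF p])
    have pS: "p + real (Suc k) * \<omega> = p + real k * \<omega> + \<omega>" for k
      by (simp add: algebra_simps)
    from one_sided[OF L] have False
    proof
      assume *: "\<forall>\<theta>\<in>R. \<delta> \<le> L \<theta>"
      show False
      proof (rule positive_sequence_not_bounded[OF a1])
        \<comment> \<open>On the upper branch the gap from \<open>L\<close> to \<open>\<mu>\<close>
          is multiplied by \<open>a\<close> at each step, while \<open>L \<ge> \<delta>\<close>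
          keeps it bounded.\<close>
        let ?v = "\<lambda>k. \<mu> (p + real k * \<omega>) - L (p + real k * \<omega>)"
        show "?v 0 > 0"
          using L_bounds(2)[of p] c(1) by simp
        show "?v (Suc k) = a * ?v k" for k
        proof -
          have "\<delta> \<le> L (p + real k * \<omega>)" using * pk by blast
          then have "h2 a \<delta> (L (p + real k * \<omega>)) = a * (L (p + real k * \<omega>) - \<delta>)"
            using \<delta> by (auto simp: h2_def)
          then show ?thesis
            unfolding pS \<mu>S L_step by (simp add: algebra_simps)
        qed
        show "?v k \<le> S + \<bar>b\<bar> * V" for k
          using * pk[of k] bV[of "p + real k * \<omega>"] \<delta> by (simp add: \<mu>_def abs_le_iff) (smt (verit) pk)
      qed
    next
      assume *: "\<forall>\<theta>\<in>R. L \<theta> \<le> - \<delta>"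
      show False
      proof (rule positive_sequence_not_bounded[OF a1])
        let ?v = "\<lambda>k. L (p + real k * \<omega>) - \<mu>' (p + real k * \<omega>)"
        show "?v 0 > 0"
          using L_bounds(1)[of p] c(1) by simp
        show "?v (Suc k) = a * ?v k" for k
        proof -
          have "L (p + real k * \<omega>) \<le> - \<delta>" using * pk by blast
          then have "h2 a \<delta> (L (p + real k * \<omega>)) = a * (L (p + real k * \<omega>) + \<delta>)"
            using \<delta> by (auto simp: h2_def)
          then show ?thesis
            unfolding pS \<mu>S' L_step by (simp add: algebra_simps)
        qed
        show "?v k \<le> S + \<bar>b\<bar> * V" for k
          using * pk[of k] bV[of "p + real k * \<omega>"] \<delta> by (simp add: \<mu>'_def abs_le_iff) (smt (verit) pk)
      qed
    qed
    then show ?thesis ..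
  qed
qed

section \<open>Divergence beyond the collision\<close>

text \<open>The factor \<open>s\<close> lets upward and downward escape share one argument; a
  convergent sequence is bounded, whereas the gap to \<open>\<mu>\<close> is not.\<close>

lemma (in forced_rotation) not_convergent_of_expanding:
  assumes a1: "a > 1"
    and step: "\<And>n \<theta>. s * \<phi> (Suc n) (\<theta> + \<omega>) - \<mu> (\<theta> + \<omega>) \<ge> a * (s * \<phi> n \<theta> - \<mu> \<theta>)"
    and gap: "\<And>\<theta>. s * \<phi> 0 \<theta> - \<mu> \<theta> = s * (b * \<kappa> \<theta>) + t"
    and pos: "s * (b * \<kappa> \<theta>0) + t > 0"
  shows "\<not> convergent (\<lambda>n. \<phi> n \<theta>)"
proof
  assume "convergent (\<lambda>n. \<phi> n \<theta>)"
  then have "convergent (\<lambda>n. s * \<phi> n \<theta> - \<mu> \<theta>)"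
    by (intro convergent_diff convergent_mult convergent_const)
  then obtain B where B: "\<And>n. \<bar>s * \<phi> n \<theta> - \<mu> \<theta>\<bar> \<le> B"
    using convergent_imp_Bseq BseqE by (metis real_norm_def)
  have "\<exists>n. s * \<phi> n \<theta> - \<mu> \<theta> > B"
    by (rule expanding_orbit_unbounded[where u = "\<lambda>n \<theta>. s * \<phi> n \<theta> - \<mu> \<theta>", OF irrational a1 step])
      (use \<kappa>_affine_circle \<kappa>_affine_cont pos in \<open>simp_all add: gap\<close>)
  with B show False
    by (meson abs_le_D1 linorder_not_le)
qed

text \<open>\<open>h2\<close> lies above its right affine branch and below its left one, so a gap
  beyond either repelling curve is expanded and never collapsed.\<close>

lemma (in forced_rotation) not_convergent_2:
  assumes a1: "a > 1" and \<delta>: "\<delta> > 0"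
    and \<phi>0: "\<And>\<theta>. \<phi> 0 \<theta> = b * g (\<theta> - \<omega>)"
    and \<phi>S: "\<And>n \<theta>. \<phi> (Suc n) \<theta> = h2 a \<delta> (\<phi> n (\<theta> - \<omega>)) + b * g (\<theta> - \<omega>)"
    and beyond: "\<bar>b * \<kappa> \<theta>0\<bar> > a * \<delta> / (a - 1)"
  shows "\<not> convergent (\<lambda>n. \<phi> n \<theta>)"
proof -
  have h: "h2 a \<delta> x = max (a * (x - \<delta>)) (min (a * (x + \<delta>)) 0)" for x
    using a1 \<delta> by (intro h2_max_min) auto
  have "a * (x - \<delta>) \<le> a * (x + \<delta>)" for x
    using a1 \<delta> by simp
  then have h_ge: "h2 a \<delta> x \<ge> a * (x - \<delta>)" and h_le: "h2 a \<delta> x \<le> a * (x + \<delta>)" for x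
    by (simp_all add: h)
  define S where "S = a * \<delta> / (a - 1)"
  have S: "a * S = S + a * \<delta>"
    using a1 by (simp add: S_def field_simps)
  consider "b * \<kappa> \<theta>0 > S" | "- (b * \<kappa> \<theta>0) > S"
    using beyond unfolding S_def by linarith
  then show ?thesis
  proof cases
    case 1
    show ?thesis
    proof (rule not_convergent_of_expanding[OF a1, where s = 1 and \<mu> = "\<lambda>\<theta>. S + b * \<nu> \<theta>" and t = "- S"])
      show "1 * \<phi> (Suc n) (\<theta> + \<omega>) - (S + b * \<nu> (\<theta> + \<omega>)) \<ge> a * (1 * \<phi> n \<theta> - (S + b * \<nu> \<theta>))" for n \<theta>
        using h_ge[of "\<phi> n \<theta>"] S unfolding \<phi>S \<nu>_step by (simp add: algebra_simps)
    qed (use 1 in \<open>simp_all add: \<phi>0 \<kappa>_def algebra_simps\<close>)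
  next
    case 2
    show ?thesis
    proof (rule not_convergent_of_expanding[OF a1, where s = "- 1" and \<mu> = "\<lambda>\<theta>. S - b * \<nu> \<theta>" and t = "- S"])
      show "- 1 * \<phi> (Suc n) (\<theta> + \<omega>) - (S - b * \<nu> (\<theta> + \<omega>)) \<ge> a * (- 1 * \<phi> n \<theta> - (S - b * \<nu> \<theta>))" for n \<theta>
        using h_le[of "\<phi> n \<theta>"] S unfolding \<phi>S \<nu>_step by (simp add: algebra_simps)
    qed (use 2 in \<open>simp_all add: \<phi>0 \<kappa>_def algebra_simps\<close>)
  qed
qed

lemma (in forced_rotation) not_convergent_3:
  assumes a1: "a > 1"
    and \<phi>0: "\<And>\<theta>. \<phi> 0 \<theta> = - 1 + b * g (\<theta> - \<omega>)"
    and \<phi>S: "\<And>n \<theta>. \<phi> (Suc n) \<theta> = h3 a (\<phi> n (\<theta> - \<omega>)) + b * g (\<theta> - \<omega>)"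
    and beyond: "b * \<kappa> \<theta>0 > 1"
  shows "\<not> convergent (\<lambda>n. \<phi> n \<theta>)"
proof (rule not_convergent_of_expanding[OF a1, where s = 1 and \<mu> = "\<lambda>\<theta>. b * \<nu> \<theta>" and t = "- 1"])
  show "1 * \<phi> (Suc n) (\<theta> + \<omega>) - b * \<nu> (\<theta> + \<omega>) \<ge> a * (1 * \<phi> n \<theta> - b * \<nu> \<theta>)" for n \<theta>
  proof -
    have "h3 a (\<phi> n \<theta>) \<ge> a * \<phi> n \<theta>"
      using a1 by (simp add: h3_max)
    then show ?thesis
      unfolding \<phi>S \<nu>_step by (simp add: algebra_simps)
  qed
qed (use beyond in \<open>simp_all add: \<phi>0 \<kappa>_def algebra_simps\<close>)

section \<open>Collisions in terms of \<open>\<kappa>\<close>, and the bifurcation value\<close>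

context forced_rotation
begin

text \<open>Superposition: \<open>t\<close> is fixed by the unforced map \<open>a * x - p\<close>,
  and \<open>q * \<nu>\<close> is the response to the forcing.\<close>

lemma affine_invariant_curve_eq:
  assumes "a * t = t + p" and R: "\<And>x \<theta>. R x \<theta> = a * x - p + q * g \<theta>"
  shows "invariant_curve \<omega> R = (\<lambda>\<theta>. t + q * \<nu> \<theta>)"
proof (rule invariant_curve_affine[OF a, where r = "\<lambda>\<theta>. q * g \<theta> - p"])
  show "t + q * \<nu> (\<theta> + \<omega>) = a * (t + q * \<nu> \<theta>) + (q * g \<theta> - p)" for \<theta>
    using assms(1) unfolding \<nu>_step by (simp add: algebra_simps)
qed (use g_circle \<nu>_circle R in \<open>auto simp: on_circle_def intro!: continuous_intros g_cont \<nu>_cont\<close>)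

text \<open>The two possible meetings are those of \<open>b * \<kappa>\<close> with a level and its
  negative. The level is half the width of the strip for \<open>i = 1\<close> and the fixed point of
  \<open>a * (x - \<delta>)\<close> for \<open>i = 2\<close>.\<close>

lemma collision_two_sided:
  assumes "i \<in> {1, 2}" "a > 1" "\<delta> > 0"
  shows "collision i a \<delta> \<omega> g b \<longleftrightarrow>
    (\<exists>\<theta>. \<bar>b * \<kappa> \<theta>\<bar> = (if i = 1 then pi / 2 else a * \<delta> / (a - 1)))"
proof -
  define S where "S = a * \<delta> / (a - 1)"
  have S: "a * S = S + a * \<delta>"
    using assms(2) by (simp add: S_def field_simps)
  have 1: "invariant_curve \<omega> (\<lambda>x \<theta>. a * x - b * g \<theta>) = (\<lambda>\<theta>. 0 + (- b) * \<nu> \<theta>)"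
    by (rule affine_invariant_curve_eq[where p = 0]) simp_all
  have 2: "invariant_curve \<omega> (\<lambda>x \<theta>. a * (x - \<delta>) + b * g \<theta>) = (\<lambda>\<theta>. S + b * \<nu> \<theta>)"
    by (rule affine_invariant_curve_eq[where p = "a * \<delta>"]) (use S in \<open>auto simp: algebra_simps\<close>)
  have 3: "invariant_curve \<omega> (\<lambda>x \<theta>. a * (x + \<delta>) + b * g \<theta>) = (\<lambda>\<theta>. - S + b * \<nu> \<theta>)"
    by (rule affine_invariant_curve_eq[where p = "- a * \<delta>"]) (use S in \<open>auto simp: algebra_simps\<close>)
  show ?thesis
  proof (cases "i = 1")
    case True
    have "- (b * \<nu> \<theta>) = pi / 2 - b * g (\<theta> - \<omega>) \<longleftrightarrow> b * \<kappa> \<theta> = pi / 2"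
      "- (b * \<nu> \<theta>) = - (pi / 2) - b * g (\<theta> - \<omega>) \<longleftrightarrow> b * \<kappa> \<theta> = - (pi / 2)" for \<theta>
      by (auto simp: \<kappa>_def right_diff_distrib)
    moreover have "\<bar>x\<bar> = pi / 2 \<longleftrightarrow> x = pi / 2 \<or> x = - (pi / 2)" for x
      using pi_gt_zero by linarith
    ultimately show ?thesis
      using True by (auto simp: collision_def graphs_meet_def mu_curve_def 1 initial_curve_def gamma_tilde1_def)
  next
    case False
    then have i: "i = 2" using assms(1) by simp
    have "b * g (\<theta> - \<omega>) = S + b * \<nu> \<theta> \<longleftrightarrow> b * \<kappa> \<theta> = S"
      "b * g (\<theta> - \<omega>) = - S + b * \<nu> \<theta> \<longleftrightarrow> b * \<kappa> \<theta> = - S" for \<theta>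
      by (auto simp: \<kappa>_def right_diff_distrib)
    moreover have "S > 0"
      using assms(2,3) by (simp add: S_def)
    then have "\<bar>x\<bar> = S \<longleftrightarrow> x = S \<or> x = - S" for x
      by linarith
    ultimately show ?thesis
      unfolding i S_def[symmetric] by (auto simp: collision_def graphs_meet_def mu_curve_def mu_hat2_def 2 3 initial_curve_def)
  qed
qed

lemma collision_one_sided:
  assumes "i \<in> {3, 4}"
  shows "collision i a \<delta> \<omega> g b \<longleftrightarrow> (\<exists>\<theta>. b * \<kappa> \<theta> = 1)"
proof -
  have 3: "invariant_curve \<omega> (\<lambda>x \<theta>. a * x + b * g \<theta>) = (\<lambda>\<theta>. 0 + b * \<nu> \<theta>)"
    and 4: "invariant_curve \<omega> (\<lambda>x \<theta>. a * x - b * g \<theta>) = (\<lambda>\<theta>. 0 + (- b) * \<nu> \<theta>)"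
    by (rule affine_invariant_curve_eq[where p = 0]; simp)+
  have "- 1 + b * g (\<theta> - \<omega>) = b * \<nu> \<theta> \<longleftrightarrow> b * \<kappa> \<theta> = 1"
    "1 - b * g (\<theta> - \<omega>) = - (b * \<nu> \<theta>) \<longleftrightarrow> b * \<kappa> \<theta> = 1" for \<theta>
    by (auto simp: \<kappa>_def right_diff_distrib)
  then show ?thesis
    using assms by (auto simp: collision_def graphs_meet_def mu_curve_def 3 4 initial_curve_def)
qed

end

text \<open>\<open>b * u x\<close> is linear in \<open>b\<close>, so if it is at least
  \<open>A\<close>, the value \<open>A\<close> was attained already at the parameter
  \<open>A / u x \<le> b\<close>.\<close>

lemma first_hitting_below:
  fixes u :: "'a \<Rightarrow> real"
  assumes "\<And>b x. b > 0 \<Longrightarrow> b * u x = A \<Longrightarrow> b0 \<le> b" "A > 0" "0 < b" "b < b0"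
  shows "b * u x < A"
proof (rule ccontr)
  assume "\<not> b * u x < A"
  then have "b * u x \<ge> A" by simp
  then have u: "u x > 0"
    using assms(2,3) by (smt (verit) zero_less_mult_pos)
  then have "b0 \<le> A / u x"
    using assms(2) by (intro assms(1)[of "A / u x" x]) simp_all
  also have "\<dots> \<le> b"
    using \<open>b * u x \<ge> A\<close> u by (simp add: pos_divide_le_eq)
  finally show False using assms(4) by simp
qed

lemma first_hitting_above:
  fixes b0 :: real
  assumes "b0 * v = A" "A > 0" "0 < b0" "b0 < b"
  shows "b * v > A"
  using assms by (metis mult_strict_right_mono zero_less_mult_pos)

section \<open>Regularity of the limit curve\<close>

theorem theorem3p8:
  fixes i :: nat and a b \<delta> \<omega> \<tau> bstar :: real and g :: "real \<Rightarrow> real"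
  assumes "i \<in> {1, 2, 3, 4}"
    and "i \<in> {1, 2, 3} \<Longrightarrow> a > 1"
    and "i = 4 \<Longrightarrow> a < - 1"
    and "\<delta> > 0"
    and "\<omega> \<notin> (\<lambda>q. 2 * pi * q) ` \<rat>"
    and "\<tau> > 0"
    and "g \<in> holder_class (1 + \<tau>)"
    and "is_bifurcation_value i a \<delta> \<omega> g bstar"
    and "0 < b \<and> b < bstar \<or> b > bstar"
    and "b > bstar \<or> i = 2 \<Longrightarrow> \<forall>\<theta>. convergent (\<lambda>n. iterated_curve i a \<delta> \<omega> g b n \<theta>)"
  shows "\<exists>phi_inf. (\<forall>\<theta>. (\<lambda>n. iterated_curve i a \<delta> \<omega> g b n \<theta>) \<longlonglongrightarrow> phi_inf \<theta>) \<and>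
              piecewise_holder (1 + \<tau>) phi_inf"
proof -
  let ?\<phi> = "iterated_curve i a \<delta> \<omega> g b"
  have g: "on_circle g" "continuous_on UNIV g"
    using assms(7) by (rule holder_class_on_circle, rule holder_class_continuous)
  have abs_a: "\<bar>a\<bar> > 1"
    using assms(1-3) by fastforce
  obtain \<nu> where \<nu>: "on_circle \<nu>" "continuous_on UNIV \<nu>" "\<And>\<theta>. \<nu> (\<theta> + \<omega>) = a * \<nu> \<theta> + g \<theta>"
    using affine_invariant_curve[OF abs_a g] by blast
  \<comment> \<open>The locale predicate does not depend on \<open>b\<close>, so the collision
    criteria hold for every parameter and \<open>b\<close> can be compared with
    \<open>bstar\<close>.\<close>
  have FR: "forced_rotation \<omega> a g \<nu>"
    by unfold_locales (use assms(5) abs_a g \<nu> in auto)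
  interpret forced_rotation \<omega> a b g \<nu>
    by (rule FR)
  have holder: "piecewise_holder (1 + \<tau>) (?\<phi> n)" for n
    using assms(1-4,7) by (intro piecewise_holder_iterated_curve) auto
  have bif: "bstar > 0" "collision i a \<delta> \<omega> g bstar"
      "\<And>\<beta>. \<beta> > 0 \<Longrightarrow> collision i a \<delta> \<omega> g \<beta> \<Longrightarrow> bstar \<le> \<beta>"
    using assms(8) by (auto simp: is_bifurcation_value_def)
  have S: "a * \<delta> / (a - 1) > 0" if "i = 2"
    using assms(2,4) that by simp
  have two_sided: "(\<forall>\<theta>. \<bar>b * \<kappa> \<theta>\<bar> < A) \<and> b < bstar \<or> (\<exists>\<theta>. \<bar>b * \<kappa> \<theta>\<bar> > A) \<and> b > bstar"
    if i: "i \<in> {1, 2}" and A: "A = (if i = 1 then pi / 2 else a * \<delta> / (a - 1))" for A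
  proof -
    have coll: "collision i a \<delta> \<omega> g \<beta> \<longleftrightarrow> (\<exists>\<theta>. \<bar>\<beta> * \<kappa> \<theta>\<bar> = A)" for \<beta>
      unfolding A using i assms(2,4) by (intro forced_rotation.collision_two_sided[OF FR]) auto
    have "A > 0"
      unfolding A using i S by auto
    have b: "b > 0" using assms(9) bif(1) by linarith
    show ?thesis
      using assms(9)
    proof
      assume "0 < b \<and> b < bstar"
      moreover have "b * \<bar>\<kappa> \<theta>\<bar> < A" if "b < bstar" for \<theta>
      proof (rule first_hitting_below[of "\<lambda>\<theta>. \<bar>\<kappa> \<theta>\<bar>" A bstar])
        show "bstar \<le> \<beta>" if "\<beta> > 0" "\<beta> * \<bar>\<kappa> x\<bar> = A" for \<beta> x
          using that coll by (intro bif(3)) (auto simp: abs_mult)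
      qed (use \<open>A > 0\<close> b that in auto)
      ultimately show ?thesis
        by (simp add: abs_mult)
    next
      assume *: "b > bstar"
      obtain \<theta> where "bstar * \<bar>\<kappa> \<theta>\<bar> = A"
        using bif(1,2) coll by (auto simp: abs_mult)
      then have "b * \<bar>\<kappa> \<theta>\<bar> > A"
        using first_hitting_above[of bstar "\<bar>\<kappa> \<theta>\<bar>" A b] \<open>A > 0\<close> bif(1) * by simp
      then show ?thesis
        using b * by (auto simp: abs_mult)
    qed
  qed
  have one_sided: "(\<forall>\<theta>. b * \<kappa> \<theta> < 1) \<and> b < bstar \<or> (\<exists>\<theta>. b * \<kappa> \<theta> > 1) \<and> b > bstar"
    if i: "i \<in> {3, 4}"
  proof -
    have coll: "collision i a \<delta> \<omega> g \<beta> \<longleftrightarrow> (\<exists>\<theta>. \<beta> * \<kappa> \<theta> = 1)" for \<beta>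
      using i by (intro forced_rotation.collision_one_sided[OF FR])
    show ?thesis
      using assms(9)
    proof
      assume *: "0 < b \<and> b < bstar"
      have "b * \<kappa> \<theta> < 1" for \<theta>
      proof (rule first_hitting_below[of \<kappa> 1 bstar])
        show "bstar \<le> \<beta>" if "\<beta> > 0" "\<beta> * \<kappa> x = 1" for \<beta> x
          using that coll by (intro bif(3)) auto
      qed (use * in auto)
      with * show ?thesis by blast
    next
      assume *: "b > bstar"
      obtain \<theta> where "bstar * \<kappa> \<theta> = 1"
        using bif(2) coll by auto
      then have "b * \<kappa> \<theta> > 1"
        using first_hitting_above[of bstar "\<kappa> \<theta>" 1 b] bif(1) * by simp
      with * show ?thesis by blast
    qed
  qed
  have "\<exists>N. ?\<phi> (Suc N) = ?\<phi> N"
  proof -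
    consider "i = 1" | "i = 2" | "i = 3" | "i = 4"
      using assms(1) by auto
    then show ?thesis
    proof cases
      case 1
      have "(\<forall>\<theta>. b * \<kappa> \<theta> < pi / 2) \<or> (\<exists>\<theta>. \<bar>b * \<kappa> \<theta>\<bar> > pi / 2)"
      proof -
        have "(\<forall>\<theta>. \<bar>b * \<kappa> \<theta>\<bar> < pi / 2) \<or> (\<exists>\<theta>. \<bar>b * \<kappa> \<theta>\<bar> > pi / 2)"
          using two_sided[of "pi / 2"] 1 by auto
        moreover have "b * \<kappa> \<theta> < pi / 2" if "\<bar>b * \<kappa> \<theta>\<bar> < pi / 2" for \<theta>
          using that by linarith
        ultimately show ?thesis by blast
      qed
      then show ?thesis
        using 1 assms(2)
        by (intro stationary_1) (simp_all add: initial_curve_def graph_transform_eq fibre_fun_def forcing_sign_def)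
    next
      case 2
      have \<phi>: "?\<phi> 0 \<theta> = b * g (\<theta> - \<omega>)" "?\<phi> (Suc n) \<theta> = h2 a \<delta> (?\<phi> n (\<theta> - \<omega>)) + b * g (\<theta> - \<omega>)" for n \<theta>
        using 2 by (simp_all add: initial_curve_def graph_transform_eq fibre_fun_def forcing_sign_def)
      have a1: "a > 1" and conv: "convergent (\<lambda>n. ?\<phi> n \<theta>)" for \<theta>
        using 2 assms(2,10) by auto
      \<comment> \<open>Crossing either repelling curve makes the iterates diverge, so the assumed
        convergence leaves only the case below the bifurcation value.\<close>
      have "\<not> \<bar>b * \<kappa> \<theta>\<bar> > a * \<delta> / (a - 1)" for \<theta>
        using not_convergent_2[where \<phi> = ?\<phi>, OF a1 assms(4) \<phi>] conv by blast
      then have "\<bar>b * \<kappa> \<theta>\<bar> < a * \<delta> / (a - 1)" for \<theta>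
        using two_sided 2 S by auto
      then show ?thesis
        using holder conv by (intro stationary_2[OF a1 assms(4) \<phi>]) (auto simp: piecewise_holder_def)
    next
      case 3
      have \<phi>: "?\<phi> 0 \<theta> = - 1 + b * g (\<theta> - \<omega>)" "?\<phi> (Suc n) \<theta> = h3 a (?\<phi> n (\<theta> - \<omega>)) + b * g (\<theta> - \<omega>)" for n \<theta>
        using 3 by (simp_all add: initial_curve_def graph_transform_eq fibre_fun_def forcing_sign_def)
      have a1: "a > 1"
        using 3 assms(2) by simp
      \<comment> \<open>For \<open>b > bstar\<close> convergence is a hypothesis that
        \<open>not_convergent_3\<close> refutes, so only \<open>b < bstar\<close> remains.\<close>
      have "b * \<kappa> \<theta> < 1" for \<theta>
        using one_sided 3 assms(10) not_convergent_3[where \<phi> = ?\<phi>, OF a1 \<phi>] by blast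
      then show ?thesis
        by (rule stationary_3[OF a1 \<phi>])
    next
      case 4
      show ?thesis
        by (rule stationary_4)
          (use 4 assms(3) one_sided in \<open>auto simp: initial_curve_def graph_transform_eq fibre_fun_def forcing_sign_def\<close>)
    qed
  qed
  then obtain N where "?\<phi> (Suc N) = ?\<phi> N" ..
  then show ?thesis
    using iterated_curve_stationary_limit holder by blast
qed

end
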